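(* Let $\psi=(\psi_{\alpha\beta})_{\alpha,\beta=1,\dots,9}$ be the skew-symmetric matrix of Kähler forms of the complex structures $J_{\alpha\beta}=\mathcal I_\alpha\mathcal I_\beta$ of the standard $\mathrm{Spin}(9)$-structure on $\mathbb{R}^{16}\cong\mathbb{O}^2$. Then its characteristic polynomial reduces to $$\det(tI-\psi)=t^9+\tau_4(\psi)t^5+\tau_8(\psi)t ,$$ that is, all the other coefficients $\tau_k(\psi)$ (of $t^{9-k}$, $k\geq1$, $k\ne4,8$) vanish.
   Context: Octonions: $\mathbb{O}=\mathbb{H}\oplus\mathbb{H}e$ with product $(h_1+h_2e)(h_1'+h_2'e)=(h_1h_1'-\overline{h_2'}h_2)+(h_2\overline{h_1'}+h_2'h_1)e$, real orthonormal basis $1,i,j,k,e,f=ie,g=je,h=ke$. $R_u$ is right multiplication $x\mapsto xu$ on $\mathbb{O}\cong\mathbb{R}^8$. The standard $\mathrm{Spin}(9)$-structure on $\mathbb{R}^{16}=\mathbb{O}^2$ is spanned by the symmetric, pairwise anticommuting involutions $\mathcal I_1=\begin{pmatrix}0&\mathrm{Id}\\ \mathrm{Id}&0\end{pmatrix}$, $\mathcal I_{2},\dots,\mathcal I_8=\begin{pmatrix}0&-R_u\\ R_u&0\end{pmatrix}$ for $u=i,j,k,e,f,g,h$ respectively, $\mathcal I_9=\begin{pmatrix}\mathrm{Id}&0\\0&-\mathrm{Id}\end{pmatrix}$. The Kähler form of $J_{\alpha\beta}$ ($\alpha\neq\beta$) is the $2$-form $\psi_{\alpha\beta}(X,Y)=\langle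 X,J_{\alpha\beta}Y\rangle$, and $\psi_{\alpha\alpha}=0$. The determinant is computed in the commutative algebra of even-degree exterior forms on $\mathbb{R}^{16}$, with wedge product; $\tau_k(\psi)\in\Lambda^{2k}\mathbb{R}^{16}$. *)

theory Defs
  imports "HOL-Analysis.Linear_Algebra" "Jordan_Normal_Form.Char_Poly"
begin

section \<open>Exterior forms of even degree\<close>

text \<open>
  An exterior form \<alpha> on \<open>V\<close> with components in several degrees is a function on lists of
  vectors: on lists of length \<open>k\<close> it is the component of \<alpha> in \<open>\<Lambda>\<^sup>k V\<close>, an alternating
  \<open>k\<close>-linear form.
\<close>

definition multilinear :: "('v::real_vector list \<Rightarrow> real) \<Rightarrow> bool" where
  "multilinear \<alpha> \<longleftrightarrow> (\<forall>us ws. linear (\<lambda>v. \<alpha> (us @ v # ws)))"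

definition alternating :: "('v list \<Rightarrow> real) \<Rightarrow> bool" where
  "alternating \<alpha> \<longleftrightarrow> (\<forall>vs. \<not> distinct vs \<longrightarrow> \<alpha> vs = 0)"

definition even_degrees :: "('v list \<Rightarrow> real) \<Rightarrow> bool" where
  "even_degrees \<alpha> \<longleftrightarrow> (\<forall>vs. odd (length vs) \<longrightarrow> \<alpha> vs = 0)"

text \<open>
  The wedge product is the sum over shuffles. The positions in \<open>S\<close> go to the first factor, and the
  sign is that of the permutation listing \<open>S\<close> before its complement. There is no factorial
  normalisation: \<open>(\<alpha> \<and> \<beta>)(v, w) = \<alpha>(v) \<beta>(w) - \<alpha>(w) \<beta>(v)\<close> for 1-forms.
\<close>

definition shuffle_sign :: "nat \<Rightarrow> nat set \<Rightarrow> real" where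
  "shuffle_sign n S = (-1) ^ card {(i, j). i \<in> S \<and> j \<in> {..<n} - S \<and> j < i}"

definition wedge :: "('v list \<Rightarrow> real) \<Rightarrow> ('v list \<Rightarrow> real) \<Rightarrow> 'v list \<Rightarrow> real" where
  "wedge \<alpha> \<beta> vs =
    (\<Sum>S\<in>Pow {..<length vs}. shuffle_sign (length vs) S * \<alpha> (nths vs S) * \<beta> (nths vs (- S)))"

definition interior :: "'v \<Rightarrow> ('v list \<Rightarrow> real) \<Rightarrow> 'v list \<Rightarrow> real" where
  "interior v \<alpha> vs = \<alpha> (v # vs)"

definition grade_inv :: "('v list \<Rightarrow> real) \<Rightarrow> 'v list \<Rightarrow> real" where
  "grade_inv \<alpha> vs = (-1) ^ length vs * \<alpha> vs"

lemma wedge_Nil: "wedge \<alpha> \<beta> [] = \<alpha> [] * \<beta> []"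
  by (simp add: wedge_def shuffle_sign_def)

lemma shuffle_sign_insert_0:
  assumes "T \<subseteq> {..<n}"
  shows "shuffle_sign (Suc n) (insert 0 (Suc ` T)) = shuffle_sign n T"
proof -
  have "{(i, j). i \<in> insert 0 (Suc ` T) \<and> j \<in> {..<Suc n} - insert 0 (Suc ` T) \<and> j < i}
      = map_prod Suc Suc ` {(i, j). i \<in> T \<and> j \<in> {..<n} - T \<and> j < i}" (is "?L = ?R")
  proof (intro equalityI subsetI)
    fix p assume "p \<in> ?L"
    then obtain i j where p: "p = (Suc i, Suc j)" "i \<in> T" "Suc j < Suc n" "Suc j \<notin> Suc ` T" "j < i"
      by (cases p; cases "snd p") auto
    then show "p \<in> ?R" by (force simp: image_iff)
  qed auto
  moreover have "inj_on (map_prod Suc Suc) A" for A :: "(nat \<times> nat) set"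
    by (auto simp: inj_on_def)
  ultimately show ?thesis by (simp add: shuffle_sign_def card_image)
qed

lemma shuffle_sign_Suc:
  assumes "T \<subseteq> {..<n}"
  shows "shuffle_sign (Suc n) (Suc ` T) = (-1) ^ card T * shuffle_sign n T"
proof -
  have eq: "{(i, j). i \<in> Suc ` T \<and> j \<in> {..<Suc n} - Suc ` T \<and> j < i}
      = (\<lambda>i. (Suc i, 0)) ` T \<union> map_prod Suc Suc ` {(i, j). i \<in> T \<and> j \<in> {..<n} - T \<and> j < i}"
    (is "?L = ?A \<union> map_prod Suc Suc ` ?B")
  proof (intro equalityI subsetI)
    fix p assume "p \<in> ?L"
    then obtain i j where p: "p = (Suc i, j)" "i \<in> T" "j < Suc n" "j \<notin> Suc ` T" "j < Suc i"
      by (cases p) auto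
    then show "p \<in> ?A \<union> map_prod Suc Suc ` ?B" by (cases j) (force simp: image_iff)+
  qed auto
  have fin: "finite T" using assms finite_subset by blast
  have "finite ?B" by (rule finite_subset[of _ "T \<times> {..<n}"]) (use fin in auto)
  then have "card (?A \<union> map_prod Suc Suc ` ?B) = card ?A + card (map_prod Suc Suc ` ?B)"
    using fin by (intro card_Un_disjoint) auto
  moreover have "card ?A = card T" by (intro card_image) (auto simp: inj_on_def)
  moreover have "card (map_prod Suc Suc ` ?B) = card ?B" by (intro card_image) (auto simp: inj_on_def)
  ultimately show ?thesis by (simp only: shuffle_sign_def eq power_add)
qed

lemma Pow_lessThan_Suc:
  "Pow {..<Suc n} = (\<lambda>T. insert 0 (Suc ` T)) ` Pow {..<n} \<union> (`) Suc ` Pow {..<n}"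
proof (intro equalityI subsetI)
  fix S assume S: "S \<in> Pow {..<Suc n}"
  define T where "T = {i. Suc i \<in> S}"
  have T: "T \<in> Pow {..<n}" using S by (auto simp: T_def)
  have S_eq: "S = (if 0 \<in> S then insert 0 (Suc ` T) else Suc ` T)"
  proof (rule Set.set_eqI)
    show "i \<in> S \<longleftrightarrow> i \<in> (if 0 \<in> S then insert 0 (Suc ` T) else Suc ` T)" for i
      by (cases i) (auto simp: T_def)
  qed
  show "S \<in> (\<lambda>T. insert 0 (Suc ` T)) ` Pow {..<n} \<union> (`) Suc ` Pow {..<n}"
  proof (cases "0 \<in> S")
    case True
    then have "S = insert 0 (Suc ` T)" using S_eq by simp
    then show ?thesis using T by blast
  next
    case False
    then have "S = Suc ` T" using S_eq by simp
    then show ?thesis using T by blast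
  qed
qed auto

lemma wedge_Cons:
  "wedge \<alpha> \<beta> (v # vs) =
    wedge (interior v \<alpha>) \<beta> vs + wedge (grade_inv \<alpha>) (interior v \<beta>) vs"
proof -
  let ?n = "length vs"
  let ?f = "\<lambda>S. shuffle_sign (Suc ?n) S * \<alpha> (nths (v # vs) S) * \<beta> (nths (v # vs) (- S))"
  have inj1: "inj_on (\<lambda>T. insert 0 (Suc ` T)) (Pow {..<?n})"
    by (rule inj_onI) (auto simp: set_eq_iff image_iff dest: spec[of _ "Suc _"])
  have inj2: "inj_on ((`) Suc) (Pow {..<?n})"
    by (rule inj_onI) (simp add: inj_image_eq_iff)
  have c: "{j. Suc j \<in> - insert 0 (Suc ` T)} = - T" "{j. Suc j \<in> - (Suc ` T)} = - T"
      "{j. Suc j \<notin> Suc ` T} = - T"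
      "{j. Suc j \<in> insert 0 (Suc ` T)} = T" "{j. Suc j \<in> Suc ` T} = T" for T
    by auto
  have len: "length (nths vs T) = card T" if "T \<subseteq> {..<?n}" for T
  proof -
    have "{i. i < ?n \<and> i \<in> T} = T" using that by auto
    then show ?thesis by (simp add: length_nths)
  qed
  have "wedge \<alpha> \<beta> (v # vs) = sum ?f (Pow {..<Suc ?n})" by (simp add: wedge_def)
  also have "\<dots> = sum ?f ((\<lambda>T. insert 0 (Suc ` T)) ` Pow {..<?n}) + sum ?f ((`) Suc ` Pow {..<?n})"
    unfolding Pow_lessThan_Suc by (intro sum.union_disjoint) auto
  also have "sum ?f ((\<lambda>T. insert 0 (Suc ` T)) ` Pow {..<?n}) = wedge (interior v \<alpha>) \<beta> vs"
    unfolding wedge_def sum.reindex[OF inj1] o_def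
    by (intro sum.cong refl) (simp add: nths_Cons c shuffle_sign_insert_0 interior_def)
  also have "sum ?f ((`) Suc ` Pow {..<?n}) = wedge (grade_inv \<alpha>) (interior v \<beta>) vs"
    unfolding wedge_def sum.reindex[OF inj2] o_def
    by (intro sum.cong refl) (simp add: nths_Cons c shuffle_sign_Suc interior_def grade_inv_def len)
  finally show ?thesis .
qed

lemma wedge_add_left: "wedge (\<lambda>vs. \<alpha> vs + \<alpha>' vs) \<beta> vs = wedge \<alpha> \<beta> vs + wedge \<alpha>' \<beta> vs"
  by (simp add: wedge_def algebra_simps sum.distrib)

lemma wedge_add_right: "wedge \<alpha> (\<lambda>vs. \<beta> vs + \<beta>' vs) vs = wedge \<alpha> \<beta> vs + wedge \<alpha> \<beta>' vs"
  by (simp add: wedge_def algebra_simps sum.distrib)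

lemma wedge_minus_left: "wedge (\<lambda>vs. - \<alpha> vs) \<beta> vs = - wedge \<alpha> \<beta> vs"
  by (simp add: wedge_def sum_negf)

lemma wedge_minus_right: "wedge \<alpha> (\<lambda>vs. - \<beta> vs) vs = - wedge \<alpha> \<beta> vs"
  by (simp add: wedge_def sum_negf)

lemma wedge_zero_left [simp]: "wedge (\<lambda>vs. 0) \<beta> vs = 0"
  by (simp add: wedge_def)

lemma wedge_zero_right [simp]: "wedge \<alpha> (\<lambda>vs. 0) vs = 0"
  by (simp add: wedge_def)

lemma grade_inv_grade_inv [simp]: "grade_inv (grade_inv \<alpha>) = \<alpha>"
  by (simp add: grade_inv_def fun_eq_iff flip: power_add mult.assoc)

lemma interior_grade_inv: "interior v (grade_inv \<alpha>) = (\<lambda>vs. - grade_inv (interior v \<alpha>) vs)"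
  by (simp add: grade_inv_def interior_def fun_eq_iff)

lemma interior_wedge:
  "interior v (wedge \<alpha> \<beta>) =
    (\<lambda>vs. wedge (interior v \<alpha>) \<beta> vs + wedge (grade_inv \<alpha>) (interior v \<beta>) vs)"
  by (simp add: interior_def[of v "wedge \<alpha> \<beta>"] fun_eq_iff wedge_Cons)

lemma grade_inv_wedge: "grade_inv (wedge \<alpha> \<beta>) = wedge (grade_inv \<alpha>) (grade_inv \<beta>)"
proof
  show "grade_inv (wedge \<alpha> \<beta>) vs = wedge (grade_inv \<alpha>) (grade_inv \<beta>) vs" for vs
  proof (induction vs arbitrary: \<alpha> \<beta>)
    case Nil
    show ?case by (simp add: grade_inv_def wedge_Nil)
  next
    case (Cons v vs)
    have "grade_inv (wedge \<alpha> \<beta>) (v # vs) =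
        - (grade_inv (wedge (interior v \<alpha>) \<beta>) vs + grade_inv (wedge (grade_inv \<alpha>) (interior v \<beta>)) vs)"
      by (simp add: grade_inv_def[of "wedge _ _"] wedge_Cons algebra_simps)
    also have "\<dots> = - wedge (grade_inv (interior v \<alpha>)) (grade_inv \<beta>) vs
        - wedge \<alpha> (grade_inv (interior v \<beta>)) vs"
      by (simp add: Cons.IH)
    also have "\<dots> = wedge (grade_inv \<alpha>) (grade_inv \<beta>) (v # vs)"
      by (simp add: wedge_Cons interior_grade_inv wedge_minus_left wedge_minus_right)
    finally show ?case .
  qed
qed

lemma wedge_assoc: "wedge (wedge \<alpha> \<beta>) \<gamma> vs = wedge \<alpha> (wedge \<beta> \<gamma>) vs"
proof (induction vs arbitrary: \<alpha> \<beta> \<gamma>)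
  case Nil
  show ?case by (simp add: wedge_Nil)
next
  case (Cons v vs)
  show ?case
    by (simp add: wedge_Cons interior_wedge grade_inv_wedge wedge_add_left wedge_add_right Cons.IH)
qed

definition unit_form :: "'v list \<Rightarrow> real" where
  "unit_form vs = (if vs = [] then 1 else 0)"

lemma interior_unit_form [simp]: "interior v unit_form = (\<lambda>vs. 0)"
  by (simp add: interior_def unit_form_def fun_eq_iff)

lemma grade_inv_unit_form [simp]: "grade_inv unit_form = unit_form"
  by (simp add: grade_inv_def unit_form_def fun_eq_iff)

lemma wedge_unit_left: "wedge unit_form \<alpha> vs = \<alpha> vs"
  by (induction vs arbitrary: \<alpha>) (simp_all add: wedge_Nil wedge_Cons, simp_all add: unit_form_def interior_def)

lemma wedge_unit_right: "wedge \<alpha> unit_form vs = \<alpha> vs"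
  by (induction vs arbitrary: \<alpha>) (simp_all add: wedge_Nil wedge_Cons, simp_all add: unit_form_def interior_def)

lemma wedge_commute_aux:
  "(grade_inv \<alpha> = \<alpha> \<longrightarrow> wedge \<alpha> \<beta> vs = wedge \<beta> \<alpha> vs) \<and>
   (grade_inv \<alpha> = (\<lambda>vs. - \<alpha> vs) \<longrightarrow> wedge \<alpha> \<beta> vs = wedge (grade_inv \<beta>) \<alpha> vs)"
proof (induction vs arbitrary: \<alpha> \<beta>)
  case Nil
  show ?case by (simp add: wedge_Nil) (simp add: grade_inv_def)
next
  case (Cons v vs)
  have i: "grade_inv (interior v \<alpha>) = (\<lambda>vs. - interior v (grade_inv \<alpha>) vs)" for \<alpha> :: "'a list \<Rightarrow> real"
    by (simp add: interior_grade_inv)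
  have neg: "interior v (\<lambda>vs. - \<alpha> vs) = (\<lambda>vs. - interior v \<alpha> vs)" for \<alpha> :: "'a list \<Rightarrow> real"
    by (simp add: interior_def fun_eq_iff)
  show ?case
  proof (intro conjI impI)
    assume e: "grade_inv \<alpha> = \<alpha>"
    have "grade_inv (interior v \<alpha>) = (\<lambda>vs. - interior v \<alpha> vs)" by (simp only: i e)
    then have h1: "wedge (interior v \<alpha>) \<beta> vs = wedge (grade_inv \<beta>) (interior v \<alpha>) vs"
      by (rule Cons.IH[THEN conjunct2, rule_format])
    have h2: "wedge \<alpha> (interior v \<beta>) vs = wedge (interior v \<beta>) \<alpha> vs"
      using e by (rule Cons.IH[THEN conjunct1, rule_format])
    show "wedge \<alpha> \<beta> (v # vs) = wedge \<beta> \<alpha> (v # vs)"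
      unfolding wedge_Cons e h1 h2 by (rule add.commute)
  next
    assume o: "grade_inv \<alpha> = (\<lambda>vs. - \<alpha> vs)"
    have "grade_inv (interior v \<alpha>) = interior v \<alpha>" by (simp only: i o neg minus_minus)
    then have h1: "wedge (interior v \<alpha>) \<beta> vs = wedge \<beta> (interior v \<alpha>) vs"
      by (rule Cons.IH[THEN conjunct1, rule_format])
    have h2: "wedge \<alpha> (interior v \<beta>) vs = wedge (grade_inv (interior v \<beta>)) \<alpha> vs"
      using o by (rule Cons.IH[THEN conjunct2, rule_format])
    show "wedge \<alpha> \<beta> (v # vs) = wedge (grade_inv \<beta>) \<alpha> (v # vs)"
      unfolding wedge_Cons o interior_grade_inv wedge_minus_left grade_inv_grade_inv h1 h2
      by (rule add.commute)
  qed
qed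

lemma grade_inv_even: "even_degrees \<alpha> \<Longrightarrow> grade_inv \<alpha> = \<alpha>"
proof
  show "grade_inv \<alpha> vs = \<alpha> vs" if "even_degrees \<alpha>" for vs
    using that by (cases "even (length vs)") (simp_all add: grade_inv_def even_degrees_def)
qed

lemma wedge_commute: "even_degrees \<alpha> \<Longrightarrow> wedge \<alpha> \<beta> vs = wedge \<beta> \<alpha> vs"
  using wedge_commute_aux grade_inv_even by blast

lemma even_degrees_wedge:
  assumes "even_degrees \<alpha>" "even_degrees \<beta>"
  shows "even_degrees (wedge \<alpha> \<beta>)"
proof -
  have "grade_inv (wedge \<alpha> \<beta>) = wedge \<alpha> \<beta>"
    using assms by (simp add: grade_inv_wedge grade_inv_even)
  then have g: "grade_inv (wedge \<alpha> \<beta>) vs = wedge \<alpha> \<beta> vs" for vs by simp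
  show ?thesis
    unfolding even_degrees_def
  proof (intro allI impI)
    fix vs :: "'a list" assume "odd (length vs)"
    then show "wedge \<alpha> \<beta> vs = 0" using g[of vs] by (simp add: grade_inv_def)
  qed
qed

lemma multilinear_interior:
  assumes "multilinear \<alpha>"
  shows "multilinear (interior v \<alpha>)"
  using assms[unfolded multilinear_def, rule_format, of "v # _"]
  by (simp add: multilinear_def interior_def)

lemma multilinear_grade_inv: "multilinear \<alpha> \<Longrightarrow> multilinear (grade_inv \<alpha>)"
  unfolding multilinear_def grade_inv_def
  by (simp add: linear_iff algebra_simps)

lemma linear_wedge_head:
  assumes "\<And>xs. linear (\<lambda>v. f v xs)"
  shows "linear (\<lambda>v. wedge (f v) \<beta> xs)" "linear (\<lambda>v. wedge \<beta> (f v) xs)"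
  using assms
  by (simp_all add: wedge_def linear_iff algebra_simps sum.distrib sum_distrib_left)

lemma multilinear_wedge:
  assumes "multilinear \<alpha>" "multilinear \<beta>"
  shows "multilinear (wedge \<alpha> \<beta>)"
proof -
  have "linear (\<lambda>v. wedge \<alpha> \<beta> (us @ v # ws))" for us ws
    using assms
  proof (induction us arbitrary: \<alpha> \<beta>)
    case Nil
    then have "linear (\<lambda>v. interior v \<alpha> xs)" "linear (\<lambda>v. interior v \<beta> xs)" for xs
      using Nil[unfolded multilinear_def, THEN spec, of "[]"] by (simp_all add: interior_def)
    then show ?case
      by (simp add: wedge_Cons) (intro linear_compose_add linear_wedge_head)
  next
    case (Cons u us)
    then show ?case
      by (simp add: wedge_Cons)
        (intro linear_compose_add Cons.IH multilinear_interior multilinear_grade_inv)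
  qed
  then show ?thesis by (simp add: multilinear_def)
qed

text \<open>For multilinear functions, vanishing on adjacent equal arguments is enough.\<close>

lemma alternating_iff_adjacent:
  assumes "multilinear \<alpha>"
  shows "alternating \<alpha> \<longleftrightarrow> (\<forall>us v ws. \<alpha> (us @ v # v # ws) = 0)"
proof
  assume "alternating \<alpha>"
  then show "\<forall>us v ws. \<alpha> (us @ v # v # ws) = 0" by (simp add: alternating_def)
next
  assume adj: "\<forall>us v ws. \<alpha> (us @ v # v # ws) = 0"
  have swap: "\<alpha> (us @ v # w # ws) = - \<alpha> (us @ w # v # ws)" for us v w ws
  proof -
    have l1: "linear (\<lambda>x. \<alpha> (us @ x # y # ws))" for y
      using assms by (simp add: multilinear_def)
    have l2: "linear (\<lambda>x. \<alpha> (us @ y # x # ws))" for y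
      using assms[unfolded multilinear_def, rule_format, of "us @ [y]" ws] by simp
    have "0 = \<alpha> (us @ (v + w) # (v + w) # ws)" using adj by simp
    also have "\<dots> = \<alpha> (us @ v # v # ws) + \<alpha> (us @ v # w # ws)
        + (\<alpha> (us @ w # v # ws) + \<alpha> (us @ w # w # ws))"
      by (simp add: linear_add[OF l1] linear_add[OF l2])
    finally show ?thesis using adj by simp
  qed
  have move: "\<alpha> (us @ v # xs @ v # ws) = 0" for us v xs ws
  proof (induction xs arbitrary: us)
    case Nil
    show ?case using adj by simp
  next
    case (Cons x xs)
    have "\<alpha> (us @ v # (x # xs) @ v # ws) = - \<alpha> ((us @ [x]) @ v # xs @ v # ws)"
      using swap[of us v x "xs @ v # ws"] by simp
    also have "\<dots> = 0" by (simp only: Cons.IH)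
    finally show ?case .
  qed
  show "alternating \<alpha>"
    unfolding alternating_def
  proof (intro allI impI)
    fix vs :: "'a list" assume "\<not> distinct vs"
    then obtain us v xs ws where "vs = us @ [v] @ xs @ [v] @ ws"
      using not_distinct_decomp by blast
    then show "\<alpha> vs = 0" using move by simp
  qed
qed

lemma adjacent_wedge:
  assumes "\<forall>us v ws. \<alpha> (us @ v # v # ws) = 0" "\<forall>us v ws. \<beta> (us @ v # v # ws) = 0"
  shows "wedge \<alpha> \<beta> (us @ v # v # ws) = 0"
  using assms
proof (induction us arbitrary: \<alpha> \<beta>)
  case Nil
  from Nil(1)[rule_format, of "[]"] Nil(2)[rule_format, of "[]"]
  have "interior v (interior v \<alpha>) = (\<lambda>vs. 0)" "interior v (interior v \<beta>) = (\<lambda>vs. 0)"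
    by (simp_all add: interior_def fun_eq_iff)
  then show ?case by (simp add: wedge_Cons interior_grade_inv wedge_minus_left)
next
  case (Cons u us)
  have "\<forall>us v ws. interior u \<alpha> (us @ v # v # ws) = 0" "\<forall>us v ws. interior u \<beta> (us @ v # v # ws) = 0"
    using Cons.prems(1)[rule_format, of "u # _"] Cons.prems(2)[rule_format, of "u # _"]
    by (simp_all add: interior_def)
  moreover have "\<forall>us v ws. grade_inv \<alpha> (us @ v # v # ws) = 0"
    using Cons.prems by (simp add: grade_inv_def)
  ultimately show ?case using Cons.prems by (simp add: wedge_Cons Cons.IH)
qed

lemma alternating_wedge:
  assumes "multilinear \<alpha>" "multilinear \<beta>" "alternating \<alpha>" "alternating \<beta>"
  shows "alternating (wedge \<alpha> \<beta>)"
  using assms adjacent_wedge[of \<alpha> \<beta>] multilinear_wedge[of \<alpha> \<beta>]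
  by (simp add: alternating_iff_adjacent)

typedef (overloaded) 'v even_form =
  "{\<alpha> :: 'v::euclidean_space list \<Rightarrow> real. multilinear \<alpha> \<and> alternating \<alpha> \<and> even_degrees \<alpha>}"
  morphisms eval_form Abs_even_form
  by (rule exI[of _ "\<lambda>_. 0"]) (simp add: multilinear_def alternating_def even_degrees_def linear_iff)

setup_lifting type_definition_even_form

instantiation even_form :: (euclidean_space) comm_ring_1
begin

lift_definition zero_even_form :: "'a even_form" is "\<lambda>_. 0"
  by (simp add: multilinear_def alternating_def even_degrees_def linear_iff)

lift_definition one_even_form :: "'a even_form" is unit_form
  by (auto simp: multilinear_def alternating_def even_degrees_def linear_iff unit_form_def)

lift_definition plus_even_form :: "'a even_form \<Rightarrow> 'a even_form \<Rightarrow> 'a even_form"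
  is "\<lambda>\<alpha> \<beta> vs. \<alpha> vs + \<beta> vs"
  by (simp add: multilinear_def alternating_def even_degrees_def linear_compose_add)

lift_definition uminus_even_form :: "'a even_form \<Rightarrow> 'a even_form" is "\<lambda>\<alpha> vs. - \<alpha> vs"
  by (simp add: multilinear_def alternating_def even_degrees_def linear_compose_neg)

lift_definition minus_even_form :: "'a even_form \<Rightarrow> 'a even_form \<Rightarrow> 'a even_form"
  is "\<lambda>\<alpha> \<beta> vs. \<alpha> vs - \<beta> vs"
  by (simp add: multilinear_def alternating_def even_degrees_def linear_compose_sub)

lift_definition times_even_form :: "'a even_form \<Rightarrow> 'a even_form \<Rightarrow> 'a even_form" is wedge
  by (simp add: multilinear_wedge alternating_wedge even_degrees_wedge)

instance
proof
  fix a b c :: "'a even_form"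
  show "a * b * c = a * (b * c)" by transfer (simp add: fun_eq_iff wedge_assoc)
  show "a * b = b * a" by transfer (simp add: fun_eq_iff wedge_commute)
  show "1 * a = a" by transfer (simp add: fun_eq_iff wedge_unit_left)
  show "(a + b) * c = a * c + b * c" by transfer (simp add: fun_eq_iff wedge_add_left)
  show "a + b + c = a + (b + c)" "a + b = b + a" "0 + a = a" "- a + a = 0" "a - b = a + - b"
    by (transfer; simp add: fun_eq_iff)+
  show "(0 :: 'a even_form) \<noteq> 1" by transfer (auto simp: fun_eq_iff unit_form_def)
qed

end

text \<open>\<open>Lambda k\<close> is the homogeneous part \<open>\<Lambda>\<^sup>k V\<close> (it is zero for odd \<open>k\<close> in this even algebra).\<close>

definition Lambda :: "nat \<Rightarrow> 'v::euclidean_space even_form set" where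
  "Lambda k = {\<alpha>. \<forall>vs. length vs \<noteq> k \<longrightarrow> eval_form \<alpha> vs = 0}"

text \<open>
  The 2-form given by a bilinear alternating function; unspecified if \<omega> is not of this kind,
  see \<open>eval_two_form\<close>.
\<close>

definition two_form :: "('v::euclidean_space \<Rightarrow> 'v \<Rightarrow> real) \<Rightarrow> 'v even_form" where
  "two_form \<omega> = Abs_even_form (\<lambda>vs. case vs of [X, Y] \<Rightarrow> \<omega> X Y | _ \<Rightarrow> 0)"

lemma eval_two_form:
  assumes "bilinear \<omega>" "\<And>X. \<omega> X X = 0"
  shows "eval_form (two_form \<omega>) vs = (case vs of [X, Y] \<Rightarrow> \<omega> X Y | _ \<Rightarrow> 0)"
proof -
  have "linear (\<lambda>v. case us @ v # ws of [X, Y] \<Rightarrow> \<omega> X Y | _ \<Rightarrow> 0)" for us ws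
  proof -
    have l: "linear (\<lambda>v. \<omega> v w)" "linear (\<omega> w)" "linear (\<lambda>v :: 'a. 0 :: real)" for w
      using assms(1) by (simp_all add: bilinear_def linear_iff)
    consider "us = []" | u where "us = [u]" | u u' us' where "us = u # u' # us'"
      by (metis neq_Nil_conv)
    then show ?thesis
    proof cases
      case 1
      consider "ws = []" | w where "ws = [w]" | w w' ws' where "ws = w # w' # ws'"
        by (metis neq_Nil_conv)
      then show ?thesis using 1 by cases (simp_all add: l)
    next
      case 2
      then show ?thesis by (cases ws) (simp_all add: l)
    next
      case 3
      then show ?thesis by (cases us') (simp_all add: l)
    qed
  qed
  then show ?thesis
    using assms(2) unfolding two_form_def
    by (subst Abs_even_form_inverse)
      (auto simp: multilinear_def alternating_def even_degrees_def split: list.splits)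
qed

section \<open>Quaternions and octonions\<close>

text \<open>
  As real Euclidean spaces, \<open>\<H> = \<real>\<^sup>4\<close> in the basis \<open>1, i, j, k\<close> and \<open>\<O> = \<H> \<oplus> \<H>e\<close>, so that the
  library's inner product on \<open>\<O> \<times> \<O> = \<real>\<^sup>1\<^sup>6\<close> is the standard one.
\<close>

type_synonym quat = "real \<times> real \<times> real \<times> real"
type_synonym octo = "quat \<times> quat"

fun qmult :: "quat \<Rightarrow> quat \<Rightarrow> quat" where
  "qmult (a, b, c, d) (a', b', c', d') =
    (a * a' - b * b' - c * c' - d * d',
     a * b' + b * a' + c * d' - d * c',
     a * c' - b * d' + c * a' + d * b',
     a * d' + b * c' - c * b' + d * a')"

fun qcnj :: "quat \<Rightarrow> quat" where
  "qcnj (a, b, c, d) = (a, - b, - c, - d)"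

fun omult :: "octo \<Rightarrow> octo \<Rightarrow> octo" where
  "omult (h1, h2) (h1', h2') =
    (qmult h1 h1' - qmult (qcnj h2') h2, qmult h2 (qcnj h1') + qmult h2' h1)"

definition oct_i :: octo where "oct_i = ((0, 1, 0, 0), 0)"
definition oct_j :: octo where "oct_j = ((0, 0, 1, 0), 0)"
definition oct_k :: octo where "oct_k = ((0, 0, 0, 1), 0)"
definition oct_e :: octo where "oct_e = (0, (1, 0, 0, 0))"
definition oct_f :: octo where "oct_f = omult oct_i oct_e"
definition oct_g :: octo where "oct_g = omult oct_j oct_e"
definition oct_h :: octo where "oct_h = omult oct_k oct_e"

lemmas oct_unit_defs = oct_i_def oct_j_def oct_k_def oct_e_def oct_f_def oct_g_def oct_h_def

definition R_mult :: "octo \<Rightarrow> octo \<Rightarrow> octo" where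
  "R_mult u x = omult x u"

section \<open>The standard Spin(9)-structure and its Kaehler forms\<close>

text \<open>In the following two definitions only the indices \<open>\<alpha> = 2, \<dots>, 8\<close>, respectively \<open>\<alpha> = 1, \<dots>, 9\<close>, are meaningful.\<close>

definition imag_unit :: "nat \<Rightarrow> octo" where
  "imag_unit \<alpha> = [oct_i, oct_j, oct_k, oct_e, oct_f, oct_g, oct_h] ! (\<alpha> - 2)"

definition spin9 :: "nat \<Rightarrow> octo \<times> octo \<Rightarrow> octo \<times> octo" where
  "spin9 \<alpha> = (\<lambda>(x, y).
    if \<alpha> = 1 then (y, x)
    else if \<alpha> = 9 then (x, - y)
    else (- R_mult (imag_unit \<alpha>) y, R_mult (imag_unit \<alpha>) x))"

definition J :: "nat \<Rightarrow> nat \<Rightarrow> octo \<times> octo \<Rightarrow> octo \<times> octo" where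
  "J \<alpha> \<beta> = spin9 \<alpha> \<circ> spin9 \<beta>"

definition kaehler_form :: "nat \<Rightarrow> nat \<Rightarrow> (octo \<times> octo) even_form" where
  "kaehler_form \<alpha> \<beta> = (if \<alpha> = \<beta> then 0 else two_form (\<lambda>X Y. inner X (J \<alpha> \<beta> Y)))"

text \<open>The defining properties of the structure, which make the forms \<open>kaehler_form \<alpha> \<beta>\<close> well-defined.\<close>

lemma octo_cases:
  obtains a b c d a' b' c' d' where "x = (((a, b, c, d), (a', b', c', d')) :: octo)"
proof -
  obtain p q where "x = (p, q)" by (cases x)
  then show ?thesis using that by (cases p rule: prod_cases4, cases q rule: prod_cases4) simp
qed

lemma index_cases:
  assumes "\<alpha> \<in> {2..8}"
  obtains "\<alpha> = 2" | "\<alpha> = 3" | "\<alpha> = 4" | "\<alpha> = 5" | "\<alpha> = 6" | "\<alpha> = 7" | "\<alpha> = (8::nat)"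
  using assms by (simp only: atLeastAtMost_iff) linarith

lemma R_mult_imag_unit:
  "R_mult (imag_unit 2) ((a, b, c, d), (a', b', c', d')) = ((- b, a, d, - c), (b', - a', - d', c'))"
  "R_mult (imag_unit 3) ((a, b, c, d), (a', b', c', d')) = ((- c, - d, a, b), (c', d', - a', - b'))"
  "R_mult (imag_unit 4) ((a, b, c, d), (a', b', c', d')) = ((- d, c, - b, a), (d', - c', b', - a'))"
  "R_mult (imag_unit 5) ((a, b, c, d), (a', b', c', d')) = ((- a', - b', - c', - d'), (a, b, c, d))"
  "R_mult (imag_unit 6) ((a, b, c, d), (a', b', c', d')) = ((- b', a', - d', c'), (- b, a, - d, c))"
  "R_mult (imag_unit 7) ((a, b, c, d), (a', b', c', d')) = ((- c', d', a', - b'), (- c, d, a, - b))"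
  "R_mult (imag_unit 8) ((a, b, c, d), (a', b', c', d')) = ((- d', - c', b', a'), (- d, - c, b, a))"
  by (simp_all add: R_mult_def imag_unit_def oct_unit_defs zero_prod_def)

lemma qmult_linear:
  "qmult (p + q) r = qmult p r + qmult q r" "qmult r (p + q) = qmult r p + qmult r q"
  "qmult (t *\<^sub>R p) r = t *\<^sub>R qmult p r" "qmult r (t *\<^sub>R p) = t *\<^sub>R qmult r p"
  by (cases p rule: prod_cases4, cases q rule: prod_cases4, cases r rule: prod_cases4;
      simp add: algebra_simps)+

lemma linear_R_mult: "linear (R_mult u)"
proof (rule linearI)
  show "R_mult u (x + y) = R_mult u x + R_mult u y" for x y
    by (cases u rule: prod.exhaust; cases x rule: prod.exhaust; cases y rule: prod.exhaust)
      (simp add: R_mult_def qmult_linear)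
  show "R_mult u (t *\<^sub>R x) = t *\<^sub>R R_mult u x" for t x
    by (cases u rule: prod.exhaust; cases x rule: prod.exhaust)
      (simp add: R_mult_def qmult_linear scaleR_right_diff_distrib scaleR_right_distrib)
qed

lemma R_mult_square: "\<alpha> \<in> {2..8} \<Longrightarrow> R_mult (imag_unit \<alpha>) (R_mult (imag_unit \<alpha>) x) = - x"
  by (cases x rule: octo_cases, elim index_cases) (simp_all add: R_mult_imag_unit)

lemma R_mult_anticommute:
  assumes "\<alpha> \<in> {2..8}" "\<beta> \<in> {2..8}" "\<alpha> \<noteq> \<beta>"
  shows "R_mult (imag_unit \<alpha>) (R_mult (imag_unit \<beta>) x) =
    - R_mult (imag_unit \<beta>) (R_mult (imag_unit \<alpha>) x)"
  using assms by (cases x rule: octo_cases, elim index_cases) (simp_all add: R_mult_imag_unit)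

lemma R_mult_skew:
  assumes "\<alpha> \<in> {2..8}"
  shows "inner (R_mult (imag_unit \<alpha>) x) y = - inner x (R_mult (imag_unit \<alpha>) y)"
  using assms
  by (cases x rule: octo_cases, cases y rule: octo_cases, elim index_cases)
    (simp_all add: R_mult_imag_unit)

lemma spin9_cases:
  assumes "\<alpha> \<in> {1..9}"
  obtains (first) "\<alpha> = 1" "spin9 \<alpha> = (\<lambda>(x, y). (y, x))"
    | (last) "\<alpha> = 9" "spin9 \<alpha> = (\<lambda>(x, y). (x, - y))"
    | (imag) "\<alpha> \<in> {2..8}"
        "spin9 \<alpha> = (\<lambda>(x, y). (- R_mult (imag_unit \<alpha>) y, R_mult (imag_unit \<alpha>) x))"
proof -
  consider "\<alpha> = 1" | "\<alpha> = 9" | "\<alpha> \<in> {2..8}" using assms by fastforce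
  then show ?thesis
    by cases (use that in \<open>simp_all add: spin9_def\<close>)
qed

lemma R_mult_minus [simp]: "R_mult u (- x) = - R_mult u x"
  by (rule linear_neg[OF linear_R_mult])

lemma spin9_involution:
  assumes "\<alpha> \<in> {1..9}"
  shows "spin9 \<alpha> (spin9 \<alpha> X) = X"
  using assms
  by (cases \<alpha> rule: spin9_cases) (simp_all add: R_mult_square case_prod_beta)

lemma spin9_anticommute:
  assumes "\<alpha> \<in> {1..9}" "\<beta> \<in> {1..9}" "\<alpha> \<noteq> \<beta>"
  shows "spin9 \<alpha> (spin9 \<beta> X) = - spin9 \<beta> (spin9 \<alpha> X)"
proof (cases X rule: prod.exhaust)
  case (Pair x y)
  show ?thesis
    using assms(1)
  proof (cases \<alpha> rule: spin9_cases)
    case first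
    from assms(2) show ?thesis
      by (cases \<beta> rule: spin9_cases) (use first assms(3) Pair in simp_all)
  next
    case last
    from assms(2) show ?thesis
      by (cases \<beta> rule: spin9_cases) (use last assms(3) Pair in simp_all)
  next
    case imag
    from assms(2) show ?thesis
    proof (cases \<beta> rule: spin9_cases)
      case imag_\<beta>: imag
      show ?thesis
        by (simp add: Pair imag imag_\<beta> R_mult_anticommute[OF imag(1) imag_\<beta>(1) assms(3)])
    qed (use imag Pair in simp_all)
  qed
qed

lemma spin9_symmetric:
  assumes "\<alpha> \<in> {1..9}"
  shows "inner (spin9 \<alpha> X) Y = inner X (spin9 \<alpha> Y)"
  using assms
  by (cases \<alpha> rule: spin9_cases; cases X rule: prod.exhaust; cases Y rule: prod.exhaust) (simp_all add: R_mult_skew)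

lemma linear_spin9:
  assumes "\<alpha> \<in> {1..9}"
  shows "linear (spin9 \<alpha>)"
  using assms
  by (cases \<alpha> rule: spin9_cases)
    (simp_all add: linear_iff case_prod_beta linear_add[OF linear_R_mult] linear_scale[OF linear_R_mult])

lemma J_square:
  assumes "\<alpha> \<in> {1..9}" "\<beta> \<in> {1..9}" "\<alpha> \<noteq> \<beta>"
  shows "J \<alpha> \<beta> (J \<alpha> \<beta> X) = - X"
  using assms
  by (simp add: J_def spin9_involution spin9_anticommute[of \<beta> \<alpha>] linear_neg[OF linear_spin9])

lemma J_skew:
  assumes "\<alpha> \<in> {1..9}" "\<beta> \<in> {1..9}" "\<alpha> \<noteq> \<beta>"
  shows "inner X (J \<alpha> \<beta> Y) = - inner (J \<alpha> \<beta> X) Y"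
proof -
  have "inner X (J \<alpha> \<beta> Y) = inner (spin9 \<beta> (spin9 \<alpha> X)) Y"
    using assms by (simp add: J_def flip: spin9_symmetric)
  then show ?thesis using assms spin9_anticommute[of \<beta> \<alpha> X] by (simp add: J_def)
qed

lemma eval_kaehler_form:
  assumes "\<alpha> \<in> {1..9}" "\<beta> \<in> {1..9}" "\<alpha> \<noteq> \<beta>"
  shows "eval_form (kaehler_form \<alpha> \<beta>) vs = (case vs of [X, Y] \<Rightarrow> inner X (J \<alpha> \<beta> Y) | _ \<Rightarrow> 0)"
proof -
  have "linear (J \<alpha> \<beta>)"
    unfolding J_def using assms by (intro linear_compose linear_spin9)
  then have "bilinear (\<lambda>X Y. inner X (J \<alpha> \<beta> Y))"
    by (simp add: bilinear_def linear_iff inner_add_left inner_add_right)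
  moreover have "inner X (J \<alpha> \<beta> X) = 0" for X
    using J_skew[OF assms, of X X] by (simp add: inner_commute)
  ultimately show ?thesis
    using assms(3) by (simp add: kaehler_form_def eval_two_form)
qed

lemma kaehler_form_in_Lambda:
  assumes "\<alpha> \<in> {1..9}" "\<beta> \<in> {1..9}"
  shows "kaehler_form \<alpha> \<beta> \<in> Lambda 2"
proof (cases "\<alpha> = \<beta>")
  case True
  then show ?thesis by (simp add: kaehler_form_def Lambda_def zero_even_form.rep_eq)
next
  case False
  then show ?thesis using assms by (auto simp: Lambda_def eval_kaehler_form split: list.splits)
qed

text \<open>Matrices of the library are indexed from 0, hence the shift.\<close>

definition kaehler_mat :: "(octo \<times> octo) even_form mat" where
  "kaehler_mat = mat 9 9 (\<lambda>(a, b). kaehler_form (a + 1) (b + 1))"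

definition tau :: "nat \<Rightarrow> 'a::comm_ring_1 mat \<Rightarrow> 'a" where
  "tau k A = coeff (char_poly A) (dim_row A - k)"

lemma zero_in_Lambda [simp]: "0 \<in> Lambda k"
  by (simp add: Lambda_def zero_even_form.rep_eq)

lemma add_in_Lambda: "\<alpha> \<in> Lambda k \<Longrightarrow> \<beta> \<in> Lambda k \<Longrightarrow> \<alpha> + \<beta> \<in> Lambda k"
  by (simp add: Lambda_def plus_even_form.rep_eq)

lemma minus_in_Lambda: "\<alpha> \<in> Lambda k \<Longrightarrow> - \<alpha> \<in> Lambda k"
  by (simp add: Lambda_def uminus_even_form.rep_eq)

lemma one_in_Lambda: "1 \<in> Lambda 0"
  by (simp add: Lambda_def one_even_form.rep_eq unit_form_def)

lemma sum_in_Lambda: "(\<And>i. i \<in> I \<Longrightarrow> f i \<in> Lambda k) \<Longrightarrow> sum f I \<in> Lambda k"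
  by (induction I rule: infinite_finite_induct) (simp_all add: add_in_Lambda)

lemma times_in_Lambda:
  assumes "\<alpha> \<in> Lambda k" "\<beta> \<in> Lambda l"
  shows "\<alpha> * \<beta> \<in> Lambda (k + l)"
proof -
  have "wedge (eval_form \<alpha>) (eval_form \<beta>) vs = 0" if vs: "length vs \<noteq> k + l" for vs
    unfolding wedge_def
  proof (intro sum.neutral ballI)
    fix S assume S: "S \<in> Pow {..<length vs}"
    have "length (nths vs S) + length (nths vs (- S)) = length vs"
    proof -
      have "{i. i < length vs \<and> i \<in> S} \<union> {i. i < length vs \<and> i \<in> - S} = {..<length vs}" by auto
      then show ?thesis
        unfolding length_nths by (subst card_Un_disjoint[symmetric]) auto
    qed
    then have "length (nths vs S) \<noteq> k \<or> length (nths vs (- S)) \<noteq> l" using vs by auto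
    then show "shuffle_sign (length vs) S * eval_form \<alpha> (nths vs S) * eval_form \<beta> (nths vs (- S)) = 0"
      using assms by (auto simp: Lambda_def)
  qed
  then show ?thesis by (simp add: Lambda_def times_even_form.rep_eq)
qed

text \<open>The coefficient \<open>\<tau>\<^sub>k\<close> is a form of degree \<open>2k\<close>.\<close>

lemma coeff_prod_in_Lambda:
  assumes "finite I" "\<And>i m. i \<in> I \<Longrightarrow> m \<le> 1 \<Longrightarrow> coeff (p i) m \<in> Lambda (2 * (1 - m))"
    "\<And>i. i \<in> I \<Longrightarrow> degree (p i) \<le> 1" "m \<le> card I"
  shows "coeff (\<Prod>i\<in>I. p i) m \<in> Lambda (2 * (card I - m))"
  using assms
proof (induction I arbitrary: m rule: finite_induct)
  case empty
  then show ?case by (simp add: one_in_Lambda)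
next
  case (insert x I)
  have deg: "degree (prod p I) \<le> card I"
    using degree_prod_sum_le[OF insert.hyps(1), of p] sum_mono[of I "\<lambda>i. degree (p i)" "\<lambda>_. 1"] insert.prems(2)
    by (simp add: o_def)
  have "coeff (p x) i * coeff (prod p I) (m - i) \<in> Lambda (2 * (card (insert x I) - m))"
    if i: "i \<le> m" for i
  proof (cases "i \<le> 1 \<and> m - i \<le> card I")
    case True
    then have "coeff (p x) i * coeff (prod p I) (m - i) \<in> Lambda (2 * (1 - i) + 2 * (card I - (m - i)))"
      using insert.prems by (intro times_in_Lambda insert.IH) auto
    also have "2 * (1 - i) + 2 * (card I - (m - i)) = 2 * (card (insert x I) - m)"
      using True i insert.hyps by auto
    finally show ?thesis .
  next
    case False
    then have "coeff (p x) i = 0 \<or> coeff (prod p I) (m - i) = 0"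
      using insert.prems(2)[of x] deg by (meson coeff_eq_0 insertI1 not_le order.strict_trans1)
    then show ?thesis by auto
  qed
  then show ?case
    unfolding prod.insert[OF insert.hyps] coeff_mult by (intro sum_in_Lambda) simp
qed

lemma tau_in_Lambda:
  assumes "k \<le> 9"
  shows "tau k kaehler_mat \<in> Lambda (2 * k)"
proof -
  define C where "C = char_poly_matrix kaehler_mat"
  have C: "C \<in> carrier_mat 9 9" by (simp add: C_def kaehler_mat_def)
  have entry: "coeff (C $$ (a, b)) m \<in> Lambda (2 * (1 - m))" "degree (C $$ (a, b)) \<le> 1"
    if "a < 9" "b < 9" "m \<le> 1" for a b m
  proof -
    have e: "C $$ (a, b) = [: - kaehler_form (a + 1) (b + 1), if a = b then 1 else 0 :]"
      using that by (simp add: C_def char_poly_matrix_def kaehler_mat_def)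
    show "degree (C $$ (a, b)) \<le> 1" by (simp add: e)
    have "m = 0 \<or> m = 1" using that by auto
    then show "coeff (C $$ (a, b)) m \<in> Lambda (2 * (1 - m))"
      using that by (auto simp: e one_in_Lambda minus_in_Lambda kaehler_form_in_Lambda)
  qed
  have "coeff (signof p * (\<Prod>i = 0..<9. C $$ (i, p i))) m \<in> Lambda (2 * (9 - m))"
    if p: "p permutes {0..<9}" and m: "m \<le> 9" for p m
  proof -
    have "p i < 9" if "i < 9" for i using permutes_in_image[OF p, of i] that by simp
    then have "coeff (\<Prod>i = 0..<9. C $$ (i, p i)) m \<in> Lambda (2 * (card {0..<9::nat} - m))"
      using m by (intro coeff_prod_in_Lambda) (auto simp del: One_nat_def intro!: entry(1) entry(2)[where m=0])
    then show ?thesis by (simp add: sign_def minus_in_Lambda)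
  qed
  then have "coeff (det C) (9 - k) \<in> Lambda (2 * (9 - (9 - k)))"
    unfolding det_def'[OF C] coeff_sum by (intro sum_in_Lambda) auto
  then show ?thesis
    using assms by (simp add: tau_def char_poly_def C_def) (simp add: kaehler_mat_def)
qed

end

theory Submission
  imports Defs
begin

text \<open>
  Since \<open>\<psi>\<close> is skew, \<open>\<tau>\<^sub>k = 0\<close> for odd \<open>k\<close>, and only \<open>\<tau>\<^sub>2 \<in> \<Lambda>\<^sup>4\<close> and \<open>\<tau>\<^sub>6 \<in> \<Lambda>\<^sup>1\<^sup>2\<close> remain. For a unit
  vector \<open>u \<in> \<real>\<^sup>9\<close> the pullback of forms along \<open>\<Sum> u\<^sub>\<alpha> I\<^sub>\<alpha>\<close> is a ring homomorphism that
  replaces \<open>\<psi>\<close> by an orthogonally conjugate matrix, so every \<open>\<tau>\<^sub>k\<close> is invariant under Spin(9); in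
  infinitesimal form, every \<open>J\<^sub>\<alpha>\<^sub>9\<close> acts on \<open>\<tau>\<^sub>k\<close> by zero. There is no nonzero invariant 4-form, and by
  Hodge duality no nonzero invariant 12-form.

  For 4-forms, number the coordinate basis of \<open>\<O>\<^sup>2\<close> by the vectors of \<open>\<F>\<^sub>2\<^sup>4\<close>. The operators \<open>J\<^sub>\<alpha>\<^sub>9\<close> permute
  it up to sign, by translations, and some of their products act diagonally by all the
  characters of \<open>\<F>\<^sub>2\<^sup>4\<close>. Hence an invariant form vanishes on four basis vectors unless their indices
  sum to 0. On those quadruples, which are the affine planes of \<open>\<F>\<^sub>2\<^sup>4\<close>, invariance under the
  translations and the equations \<open>J\<^sub>\<alpha>\<^sub>9 \<cdot> \<omega> = 0\<close> form a linear system with only the zero solution.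
\<close>

section \<open>Invariance of the characteristic polynomial\<close>

text \<open>Real scalars as forms of degree 0: they turn real matrices into matrices over the ring
  of even forms.\<close>

lift_definition scalar_form :: "real \<Rightarrow> 'a::euclidean_space even_form" is "\<lambda>c vs. c * unit_form vs"
  by (auto simp: multilinear_def alternating_def even_degrees_def linear_iff unit_form_def)

lemma eval_zero_form: "eval_form 0 vs = 0"
  by transfer simp

lemma eval_sum: "eval_form (sum f A) vs = (\<Sum>i\<in>A. eval_form (f i) vs)"
  by (induction A rule: infinite_finite_induct) (simp_all add: eval_zero_form plus_even_form.rep_eq)

lemma eval_scalar_form_mult: "eval_form (scalar_form c * \<omega>) vs = c * eval_form \<omega> vs"
proof -
  have "wedge (\<lambda>vs. c * unit_form vs) \<beta> vs = c * wedge unit_form \<beta> vs"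
    for \<beta> :: "'a list \<Rightarrow> real" and vs
    by (simp add: wedge_def sum_distrib_left mult.assoc mult.left_commute)
  then show ?thesis
    by (simp add: times_even_form.rep_eq scalar_form.rep_eq wedge_unit_left)
qed

lemma even_form_eqI: "(\<And>vs. eval_form \<alpha> vs = eval_form \<beta> vs) \<Longrightarrow> \<alpha> = \<beta>"
  by (simp add: eval_form_inject[symmetric] fun_eq_iff)

lemma multilinear_eval_form: "multilinear (eval_form \<omega>)"
  and alternating_eval_form: "alternating (eval_form \<omega>)"
  using eval_form[of \<omega>] by auto

text \<open>The lift must yield a form for every \<open>g\<close>; for nonlinear \<open>g\<close>
  the default is the form itself.\<close>

lift_definition pullback :: "('a \<Rightarrow> 'a) \<Rightarrow> 'a::euclidean_space even_form \<Rightarrow> 'a even_form"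
  is "\<lambda>g \<alpha> vs. if linear g then \<alpha> (map g vs) else \<alpha> vs"
proof -
  fix g :: "'a \<Rightarrow> 'a" and \<alpha> :: "'a list \<Rightarrow> real"
  assume a: "multilinear \<alpha> \<and> alternating \<alpha> \<and> even_degrees \<alpha>"
  have "linear (\<lambda>v. \<alpha> (map g us @ g v # map g ws))" if "linear g" for us ws
    using linear_compose[OF that, of "\<lambda>v. \<alpha> (map g us @ v # map g ws)"] a
    by (simp add: multilinear_def o_def)
  then show "multilinear (\<lambda>vs. if linear g then \<alpha> (map g vs) else \<alpha> vs)
      \<and> alternating (\<lambda>vs. if linear g then \<alpha> (map g vs) else \<alpha> vs)
      \<and> even_degrees (\<lambda>vs. if linear g then \<alpha> (map g vs) else \<alpha> vs)"
    using a by (cases "linear g" ) (auto simp: multilinear_def alternating_def even_degrees_def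
      distinct_map)
qed

lemma eval_pullback: "linear g \<Longrightarrow> eval_form (pullback g \<omega>) vs = eval_form \<omega> (map g vs)"
  by (simp add: pullback.rep_eq)

text \<open>Shuffles only select positions, so \<open>wedge\<close> commutes with mapping
  \<open>g\<close> over the arguments. A ring homomorphism passes through determinants.\<close>

lemma comm_ring_hom_pullback:
  assumes "linear g"
  shows "comm_ring_hom (pullback g)"
proof
  show "pullback g 0 = 0" "pullback g 1 = 1"
    by (rule even_form_eqI, simp add: eval_pullback[OF assms] zero_even_form.rep_eq one_even_form.rep_eq unit_form_def)+
  show "pullback g (x + y) = pullback g x + pullback g y" for x y
    by (rule even_form_eqI) (simp add: eval_pullback[OF assms] plus_even_form.rep_eq)
  show "pullback g (x * y) = pullback g x * pullback g y" for x y
    by (rule even_form_eqI)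
      (simp add: eval_pullback[OF assms] times_even_form.rep_eq wedge_def nths_map)
qed

section \<open>Unit Clifford vectors and their action on the matrix of Kaehler forms\<close>

definition clifford :: "(nat \<Rightarrow> real) \<Rightarrow> octo \<times> octo \<Rightarrow> octo \<times> octo" where
  "clifford u X = (\<Sum>a<9. u a *\<^sub>R spin9 (Suc a) X)"

lemma linear_spin9_Suc: "a < 9 \<Longrightarrow> linear (spin9 (Suc a))"
  by (rule linear_spin9) auto

lemma linear_clifford: "linear (clifford u)"
  unfolding clifford_def
  by (intro linear_compose_sum ballI linear_compose_scale_right linear_spin9_Suc) simp

lemma spin9_clifford_relation:
  assumes "a < 9" "b < 9"
  shows "spin9 (Suc a) (spin9 (Suc b) X) = (if a = b then 2 *\<^sub>R X else 0) - spin9 (Suc b) (spin9 (Suc a) X)"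
proof -
  have "Suc a \<in> {1..9}" "Suc b \<in> {1..9}" using assms by auto
  then show ?thesis
    by (cases "a = b") (simp_all add: spin9_involution scaleR_2 spin9_anticommute[of "Suc a" "Suc b"])
qed

text \<open>The polarised Clifford relation; it turns conjugation by \<open>clifford u\<close> into
  a linear action on the generators.\<close>

lemma spin9_clifford:
  assumes "a < 9"
  shows "spin9 (Suc a) (clifford u X) = (2 * u a) *\<^sub>R X - clifford u (spin9 (Suc a) X)"
proof -
  interpret linear "spin9 (Suc a)" by (rule linear_spin9_Suc[OF assms])
  have "spin9 (Suc a) (clifford u X) =
      (\<Sum>b<9. u b *\<^sub>R (if a = b then 2 *\<^sub>R X else 0) - u b *\<^sub>R spin9 (Suc b) (spin9 (Suc a) X))"
    unfolding clifford_def sum scaleR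
    by (intro sum.cong refl) (simp add: spin9_clifford_relation[OF assms] scaleR_right_diff_distrib)
  also have "\<dots> = (\<Sum>b<9. u b *\<^sub>R (if a = b then 2 *\<^sub>R X else 0)) - clifford u (spin9 (Suc a) X)"
    by (simp add: sum_subtractf clifford_def)
  also have "(\<Sum>b<9. u b *\<^sub>R (if a = b then 2 *\<^sub>R X else 0)) = (2 * u a) *\<^sub>R X"
    using assms by (simp add: if_distrib[of "scaleR _"] mult.commute cong: if_cong)
  finally show ?thesis .
qed

lemma clifford_involution:
  assumes "(\<Sum>a<9. (u a)\<^sup>2) = 1"
  shows "clifford u (clifford u X) = X"
proof -
  interpret linear "clifford u" by (rule linear_clifford)
  have "clifford u (clifford u X) = (\<Sum>a<9. (2 * (u a)\<^sup>2) *\<^sub>R X - u a *\<^sub>R clifford u (spin9 (Suc a) X))"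
    unfolding clifford_def[of u "clifford u X"]
    by (intro sum.cong refl)
      (simp add: spin9_clifford scaleR_right_diff_distrib power2_eq_square algebra_simps)
  \<comment> \<open>The square reappears with a minus sign, so the equation can be solved for
    it.\<close>
  also have "\<dots> = 2 *\<^sub>R X - clifford u (clifford u X)"
    by (simp add: sum_subtractf scaleR_sum_left[symmetric] sum_distrib_left[symmetric] assms
        clifford_def[of u X] sum scaleR)
  finally have "2 *\<^sub>R clifford u (clifford u X) = 2 *\<^sub>R X"
    by (simp add: scaleR_2 algebra_simps)
  then show ?thesis by simp
qed

lemma clifford_symmetric: "inner (clifford u X) Y = inner X (clifford u Y)"
  unfolding clifford_def inner_sum_left inner_sum_right
  by (intro sum.cong refl) (simp add: spin9_symmetric)

text \<open>Subtracting the inner product on the diagonal covers the convention of zero diagonal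
  forms, so sums over all index pairs need no case split.\<close>

lemma eval_kaehler_form_pair:
  assumes "a < 9" "b < 9"
  shows "eval_form (kaehler_form (Suc a) (Suc b)) [X, Y] =
    inner X (spin9 (Suc a) (spin9 (Suc b) Y)) - (if a = b then inner X Y else 0)"
proof (cases "a = b")
  case True
  moreover have "Suc a \<in> {1..9}" using assms by auto
  ultimately show ?thesis by (simp add: kaehler_form_def eval_zero_form spin9_involution)
next
  case False
  then show ?thesis using assms by (subst eval_kaehler_form) (simp_all add: J_def)
qed

lemma eval_kaehler_form_degree:
  assumes "a < 9" "b < 9" "length vs \<noteq> 2"
  shows "eval_form (kaehler_form (Suc a) (Suc b)) vs = 0"
  using kaehler_form_in_Lambda[of "Suc a" "Suc b"] assms by (simp add: Lambda_def)

text \<open>Conjugation by \<open>clifford u\<close> acts on \<open>\<R>\<^sup>9\<close> as minus the reflection in the hyperplane \<open>u\<^sup>\<bottom>\<close>.\<close>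

lemma pullback_clifford_kaehler_mat:
  assumes u: "(\<Sum>a<9. (u a)\<^sup>2) = 1"
  defines "S \<equiv> mat 9 9 (\<lambda>(a, b). scalar_form (2 * u a * u b - (if a = b then 1 else 0)))"
  shows "map_mat (pullback (clifford u)) kaehler_mat = S * kaehler_mat * transpose_mat S"
    and "S * transpose_mat S = 1\<^sub>m 9"
proof -
  define s where "s a b = 2 * u a * u b - (if a = b then 1 else 0)" for a b :: nat
  define T where "T a Y = (\<Sum>c<9. s a c *\<^sub>R spin9 (Suc c) Y)" for a Y
  let ?g = "clifford u"
  have S: "S \<in> carrier_mat 9 9" "\<And>a b. a < 9 \<Longrightarrow> b < 9 \<Longrightarrow> S $$ (a, b) = scalar_form (s a b)"
    by (simp_all add: S_def s_def)
  have K: "kaehler_mat \<in> carrier_mat 9 9"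
    "\<And>a b. a < 9 \<Longrightarrow> b < 9 \<Longrightarrow> kaehler_mat $$ (a, b) = kaehler_form (Suc a) (Suc b)"
    by (simp_all add: kaehler_mat_def)
  have orth: "(\<Sum>c<9. s a c * s b c) = (if a = b then 1 else 0)" if "a < 9" "b < 9" for a b
  proof -
    have "s a c * s b c = 4 * u a * u b * (u c)\<^sup>2 - (if a = c then 2 * u b * u c else 0)
        - (if b = c then 2 * u a * u c else 0) + (if a = c then if b = c then 1 else 0 else 0)" for c
      by (simp add: s_def algebra_simps power2_eq_square)
    then have "(\<Sum>c<9. s a c * s b c) = 4 * u a * u b * (\<Sum>c<9. (u c)\<^sup>2) - 2 * u b * u a - 2 * u a * u b
        + (if a = b then 1 else 0)"
      using that by (simp add: sum.distrib sum_subtractf sum_distrib_left)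
    then show ?thesis by (simp add: u)
  qed
  have T: "T a Y = (2 * u a) *\<^sub>R ?g Y - spin9 (Suc a) Y" if "a < 9" for a Y
  proof -
    have "s a c *\<^sub>R spin9 (Suc c) Y = (2 * u a) *\<^sub>R u c *\<^sub>R spin9 (Suc c) Y - (if a = c then spin9 (Suc a) Y else 0)" for c
      by (simp add: s_def scaleR_left_diff_distrib)
    then have "T a Y = (2 * u a) *\<^sub>R (\<Sum>c<9. u c *\<^sub>R spin9 (Suc c) Y) - spin9 (Suc a) Y"
      using that by (simp add: T_def sum_subtractf scaleR_sum_right)
    then show ?thesis by (simp add: clifford_def)
  qed
  interpret g: linear ?g by (rule linear_clifford)
  have gg: "?g (?g X) = X" for X by (rule clifford_involution[OF u])
  \<comment> \<open>Conjugating a generator by the involution \<open>clifford u\<close> gives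
    \<open>T a\<close>, row \<open>a\<close> of \<open>s\<close> applied to the generators.\<close>
  have conj: "spin9 (Suc a) (?g Y) = ?g (T a Y)" if "a < 9" for a Y
    using that by (simp add: spin9_clifford T g.diff g.scaleR gg)
  show "S * transpose_mat S = 1\<^sub>m 9"
  proof (rule eq_matI)
    fix a b assume "a < dim_row (1\<^sub>m 9 :: (octo \<times> octo) even_form mat)" "b < dim_col (1\<^sub>m 9 :: (octo \<times> octo) even_form mat)"
    then have ab: "a < 9" "b < 9" by auto
    have "(\<Sum>c = 0..<9. scalar_form (s a c) * scalar_form (s b c)) = (if a = b then 1 else (0 :: (octo \<times> octo) even_form))"
      by (rule even_form_eqI)
        (simp add: eval_sum eval_scalar_form_mult orth[OF ab] scalar_form.rep_eq one_even_form.rep_eq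
          eval_zero_form mult.assoc[symmetric] sum_distrib_right[symmetric] atLeast0LessThan)
    then show "(S * transpose_mat S) $$ (a, b) = 1\<^sub>m 9 $$ (a, b)"
      using ab S by (simp add: scalar_prod_def)
  qed (use S in auto)
  have entry: "pullback ?g (kaehler_form (Suc a) (Suc b)) =
      (\<Sum>d<9. (\<Sum>c<9. scalar_form (s a c) * kaehler_form (Suc c) (Suc d)) * scalar_form (s b d))"
    (is "?L = ?R") if ab: "a < 9" "b < 9" for a b
  proof (rule even_form_eqI)
    fix vs :: "(octo \<times> octo) list"
    have R: "eval_form ?R vs = (\<Sum>d<9. \<Sum>c<9. s b d * (s a c * eval_form (kaehler_form (Suc c) (Suc d)) vs))"
      by (simp add: mult.commute[of _ "scalar_form _"] eval_sum eval_scalar_form_mult sum_distrib_left)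
    show "eval_form ?L vs = eval_form ?R vs"
    proof (cases "length vs = 2")
      case False
      then show ?thesis
        unfolding R using ab by (simp add: eval_pullback[OF linear_clifford] eval_kaehler_form_degree)
    next
      case True
      then obtain X Y where vs: "vs = [X, Y]"
        by (auto simp: numeral_2_eq_2 length_Suc_conv)
      have TT: "inner X (T a (T b Y)) = (\<Sum>d<9. \<Sum>c<9. s b d * (s a c * inner X (spin9 (Suc c) (spin9 (Suc d) Y))))"
      proof -
        have "spin9 (Suc c) (T b Y) = (\<Sum>d<9. s b d *\<^sub>R spin9 (Suc c) (spin9 (Suc d) Y))" if "c < 9" for c
          using linear_spin9_Suc[OF that] by (simp add: T_def linear_sum linear_scale)
        then have "inner X (T a (T b Y)) = (\<Sum>c<9. \<Sum>d<9. s b d * (s a c * inner X (spin9 (Suc c) (spin9 (Suc d) Y))))"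
          by (simp add: T_def[of a] inner_sum_right sum_distrib_left mult.left_commute)
        then show ?thesis by (subst sum.swap) simp
      qed
      have "eval_form ?R vs = inner X (T a (T b Y)) - (\<Sum>d<9. \<Sum>c<9. s b d * (s a c * (if c = d then inner X Y else 0)))"
        unfolding R unfolding vs TT sum_subtractf[symmetric]
        by (intro sum.cong refl) (simp add: eval_kaehler_form_pair algebra_simps)
      \<comment> \<open>The diagonal corrections collapse by orthogonality of \<open>s\<close> to
        the correction belonging to the left side.\<close>
      also have "(\<Sum>d<9. \<Sum>c<9. s b d * (s a c * (if c = d then inner X Y else 0))) = (\<Sum>d<9. s a d * s b d) * inner X Y"
        unfolding sum_distrib_right
        by (intro sum.cong refl) (simp add: if_distrib cong: if_cong)
      also have "inner X (T a (T b Y)) - (\<Sum>d<9. s a d * s b d) * inner X Y = eval_form ?L vs"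
        using ab by (simp add: vs eval_pullback[OF linear_clifford] eval_kaehler_form_pair orth conj
            clifford_symmetric gg)
      finally show ?thesis ..
    qed
  qed
  show "map_mat (pullback ?g) kaehler_mat = S * kaehler_mat * transpose_mat S"
  proof (rule eq_matI)
    fix a b assume "a < dim_row (S * kaehler_mat * transpose_mat S)" "b < dim_col (S * kaehler_mat * transpose_mat S)"
    then have ab: "a < 9" "b < 9" using S by auto
    then show "map_mat (pullback ?g) kaehler_mat $$ (a, b) = (S * kaehler_mat * transpose_mat S) $$ (a, b)"
      using S K by (simp add: scalar_prod_def entry atLeast0LessThan del: assoc_mult_mat)
  qed (use S K in auto)
qed

lemma pullback_clifford_tau:
  assumes u: "(\<Sum>a<9. (u a)\<^sup>2) = 1"
  shows "pullback (clifford u) (tau k kaehler_mat) = tau k kaehler_mat"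
proof -
  interpret comm_ring_hom "pullback (clifford u)"
    by (rule comm_ring_hom_pullback[OF linear_clifford])
  define S :: "(octo \<times> octo) even_form mat"
    where "S = mat 9 9 (\<lambda>(a, b). scalar_form (2 * u a * u b - (if a = b then 1 else 0)))"
  have K: "kaehler_mat \<in> carrier_mat 9 9" by (simp add: kaehler_mat_def)
  have S: "S \<in> carrier_mat 9 9" "S * transpose_mat S = 1\<^sub>m 9"
    using pullback_clifford_kaehler_mat(2)[OF u] by (simp_all add: S_def)
  \<comment> \<open>\<open>S\<close> is symmetric, hence its own inverse, so the conjugation is a
    similarity.\<close>
  have SS: "transpose_mat S = S"
    by (rule eq_matI) (auto simp: S_def mult.commute mult.left_commute)
  have "map_mat (pullback (clifford u)) kaehler_mat = S * kaehler_mat * S"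
    using pullback_clifford_kaehler_mat(1)[OF u] SS by (simp add: S_def)
  then have "similar_mat_wit (map_mat (pullback (clifford u)) kaehler_mat) kaehler_mat S S"
    using S K SS mult_carrier_mat[OF mult_carrier_mat[OF S(1) K] S(1)]
    by (simp add: similar_mat_wit_def Let_def)
  then have "char_poly (map_mat (pullback (clifford u)) kaehler_mat) = char_poly kaehler_mat"
    by (intro char_poly_similar) (auto simp: similar_mat_def)
  then show ?thesis
    by (simp add: tau_def char_poly_hom[OF K] flip: coeff_map_poly_hom)
qed

section \<open>Infinitesimal action on forms\<close>

text \<open>The derivation action of \<open>A\<close>: the sum over all positions of the form with
  \<open>A\<close> applied to that argument. Peeling off the first argument matches the recursion
  \<open>wedge_Cons\<close>.\<close>

primrec lie :: "('v \<Rightarrow> 'v) \<Rightarrow> ('v list \<Rightarrow> real) \<Rightarrow> 'v list \<Rightarrow> real" where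
  "lie A \<alpha> [] = 0"
| "lie A \<alpha> (v # vs) = \<alpha> (A v # vs) + lie A (interior v \<alpha>) vs"

lemma interior_eq: "interior v \<alpha> = (\<lambda>vs. \<alpha> (v # vs))"
  by (simp add: interior_def fun_eq_iff)

lemma lie_add: "lie A (\<lambda>vs. \<alpha> vs + \<beta> vs) vs = lie A \<alpha> vs + lie A \<beta> vs"
  by (induction vs arbitrary: \<alpha> \<beta>) (simp_all add: interior_eq)

lemma lie_scale: "lie A (\<lambda>vs. c * \<alpha> vs) vs = c * lie A \<alpha> vs"
  by (induction vs arbitrary: \<alpha>) (simp_all add: interior_eq algebra_simps)

lemma lie_minus: "lie A (\<lambda>vs. - \<alpha> vs) vs = - lie A \<alpha> vs"
  using lie_scale[of A "- 1" \<alpha> vs] by simp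

lemma lie_zero: "lie A (\<lambda>vs. 0) vs = 0"
  using lie_scale[of A 0] by simp

lemma interior_lie: "interior v (lie A \<alpha>) = (\<lambda>vs. interior (A v) \<alpha> vs + lie A (interior v \<alpha>) vs)"
  by (simp add: interior_def fun_eq_iff)

lemma lie_grade_inv: "lie A (grade_inv \<alpha>) = grade_inv (lie A \<alpha>)"
proof
  show "lie A (grade_inv \<alpha>) vs = grade_inv (lie A \<alpha>) vs" for vs
    by (induction vs arbitrary: \<alpha>)
      (simp_all add: interior_grade_inv lie_minus, simp_all add: grade_inv_def algebra_simps)
qed

text \<open>\<open>lie A\<close> preserves degrees and so commutes with \<open>grade_inv\<close>;
  hence the Leibniz rule carries no sign.\<close>

lemma lie_wedge: "lie A (wedge \<alpha> \<beta>) vs = wedge (lie A \<alpha>) \<beta> vs + wedge \<alpha> (lie A \<beta>) vs"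
proof (induction vs arbitrary: \<alpha> \<beta>)
  case Nil
  show ?case by (simp add: wedge_Nil)
next
  case (Cons v vs)
  show ?case
    by (simp add: wedge_Cons interior_wedge lie_add Cons.IH interior_lie wedge_add_left
        wedge_add_right lie_grade_inv algebra_simps)
qed

section \<open>One-parameter groups of rotations and infinitesimal invariance\<close>

definition rot :: "('v::real_vector \<Rightarrow> 'v) \<Rightarrow> real \<Rightarrow> 'v \<Rightarrow> 'v" where
  "rot A \<theta> v = cos \<theta> *\<^sub>R v + sin \<theta> *\<^sub>R A v"

lemma rot_simps: "rot A 0 = id" "rot A (pi / 2) = A"
  by (simp_all add: rot_def fun_eq_iff)

lemma multilinear_head:
  assumes "multilinear \<alpha>"
  shows "\<alpha> ((a *\<^sub>R x + b *\<^sub>R y) # vs) = a * \<alpha> (x # vs) + b * \<alpha> (y # vs)"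
proof -
  have "linear (\<lambda>v. \<alpha> ([] @ v # vs))" using assms unfolding multilinear_def by blast
  from linear_add[OF this] linear_scale[OF this] show ?thesis by simp
qed

text \<open>As \<open>A\<close> squares to -1, \<open>rot A \<theta>\<close> is the exponential of
  \<open>\<theta>\<close> times \<open>A\<close>, with derivative \<open>A\<close> after
  \<open>rot A \<theta>\<close>. The derivative at every angle, not just at 0, is what gives
  constancy later.\<close>

lemma DERIV_map_rot:
  assumes "multilinear \<alpha>" "linear A" "\<And>v. A (A v) = - v"
  shows "((\<lambda>\<theta>. \<alpha> (map (rot A \<theta>) vs)) has_real_derivative lie A \<alpha> (map (rot A \<theta>) vs)) (at \<theta>)"
  using assms(1)
proof (induction vs arbitrary: \<alpha>)
  case Nil
  show ?case by simp
next
  case (Cons v vs)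
  let ?m = "\<lambda>\<theta>. map (rot A \<theta>) vs"
  note ml = multilinear_head[OF Cons.prems]
  have "A (rot A \<theta> v) = cos \<theta> *\<^sub>R A v + (- sin \<theta>) *\<^sub>R v"
    by (simp add: rot_def linear_add[OF assms(2)] linear_scale[OF assms(2)] assms(3))
  then have A_rot: "\<alpha> (A (rot A \<theta> v) # ws) = cos \<theta> * \<alpha> (A v # ws) + (- sin \<theta>) * \<alpha> (v # ws)" for ws
    by (simp only: ml)
  have int_rot: "interior (rot A \<theta> v) \<alpha> = (\<lambda>ws. cos \<theta> * interior v \<alpha> ws + sin \<theta> * interior (A v) \<alpha> ws)"
    by (simp add: interior_def fun_eq_iff rot_def ml)
  have IH: "((\<lambda>\<theta>. interior w \<alpha> (?m \<theta>)) has_real_derivative lie A (interior w \<alpha>) (?m \<theta>)) (at \<theta>)" for w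
    by (rule Cons.IH[OF multilinear_interior[OF Cons.prems]])
  have "((\<lambda>\<theta>. cos \<theta> * interior v \<alpha> (?m \<theta>) + sin \<theta> * interior (A v) \<alpha> (?m \<theta>)) has_real_derivative
      lie A \<alpha> (map (rot A \<theta>) (v # vs))) (at \<theta>)"
    by (rule derivative_eq_intros IH refl)+
      (simp add: A_rot int_rot lie_add lie_scale, simp add: interior_def algebra_simps)
  then show ?case by (simp add: interior_def rot_def[of A _ v] ml)
qed

lemma lie_zero_iff_rot_invariant:
  assumes "multilinear \<alpha>" "linear A" "\<And>v. A (A v) = - v"
  shows "(\<forall>vs. lie A \<alpha> vs = 0) \<longleftrightarrow> (\<forall>\<theta> vs. \<alpha> (map (rot A \<theta>) vs) = \<alpha> vs)"
proof
  assume "\<forall>vs. lie A \<alpha> vs = 0"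
  then have "\<forall>\<theta>. ((\<lambda>\<theta>. \<alpha> (map (rot A \<theta>) vs)) has_real_derivative 0) (at \<theta>)" for vs
    using DERIV_map_rot[OF assms] by simp
  then have "\<alpha> (map (rot A \<theta>) vs) = \<alpha> (map (rot A 0) vs)" for \<theta> vs
    by (rule DERIV_isconst_all)
  then show "\<forall>\<theta> vs. \<alpha> (map (rot A \<theta>) vs) = \<alpha> vs" by (simp add: rot_simps)
next
  assume "\<forall>\<theta> vs. \<alpha> (map (rot A \<theta>) vs) = \<alpha> vs"
  then have "((\<lambda>\<theta>. \<alpha> vs) has_real_derivative lie A \<alpha> (map (rot A 0) vs)) (at 0)" for vs
    using DERIV_map_rot[OF assms, of vs 0] by simp
  then show "\<forall>vs. lie A \<alpha> vs = 0"
    using DERIV_unique[OF _ DERIV_const] by (fastforce simp: rot_simps)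
qed

text \<open>The quarter turn of the rotation group is \<open>A\<close> itself.\<close>

lemma lie_zero_imp_invariant:
  assumes "multilinear \<alpha>" "linear A" "\<And>v. A (A v) = - v" "\<And>vs. lie A \<alpha> vs = 0"
  shows "\<alpha> (map A vs) = \<alpha> vs"
proof -
  have "\<alpha> (map (rot A (pi / 2)) vs) = \<alpha> vs"
    using lie_zero_iff_rot_invariant[OF assms(1-3)] assms(4) by blast
  then show ?thesis by (simp add: rot_simps)
qed

text \<open>The infinitesimal form of \<open>det (exp A) = 1\<close> for skew \<open>A\<close>.\<close>

lemma lie_volume:
  fixes \<alpha> :: "'v::euclidean_space list \<Rightarrow> real"
  assumes \<alpha>: "multilinear \<alpha>" "alternating \<alpha>" and skew: "\<And>v. inner v (A v) = 0"
    and "distinct (us @ vs)" "set (us @ vs) = Basis"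
  shows "lie A (\<lambda>ws. \<alpha> (us @ ws)) vs = 0"
  using assms(4,5)
proof (induction vs arbitrary: us)
  case Nil
  show ?case by simp
next
  case (Cons v vs)
  let ?f = "\<lambda>x. \<alpha> (us @ x # vs)"
  have lin: "linear ?f" using \<alpha>(1) by (simp add: multilinear_def)
  have v: "v \<in> Basis" using Cons.prems by auto
  have 0: "?f b = 0" if "b \<in> Basis" "b \<noteq> v" for b
  proof -
    have "b \<in> set us \<union> set vs" using that Cons.prems by auto
    then have "\<not> distinct (us @ b # vs)" by auto
    then show ?thesis using \<alpha>(2) by (simp add: alternating_def)
  qed
  \<comment> \<open>Components of \<open>A v\<close> along other basis vectors repeat an argument;
    the component along \<open>v\<close> vanishes by skewness.\<close>
  have "?f (A v) = ?f (\<Sum>b\<in>Basis. inner (A v) b *\<^sub>R b)" by (simp add: euclidean_representation)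
  also have "\<dots> = (\<Sum>b\<in>Basis. inner (A v) b * ?f b)"
    by (simp add: linear_sum[OF lin] linear_scale[OF lin])
  also have "\<dots> = 0"
    using 0 skew[of v] by (intro sum.neutral ballI) (metis inner_commute mult_eq_0_iff)
  finally have "?f (A v) = 0" .
  moreover have "lie A (\<lambda>ws. \<alpha> ((us @ [v]) @ ws)) vs = 0"
    using Cons.prems by (intro Cons.IH) auto
  ultimately show ?case by (simp add: interior_eq)
qed

section \<open>Hodge duality for invariant forms\<close>

text \<open>The metric dual 1-form, kept as a function on lists because covectors and their products
  may have odd degree.\<close>

definition covec :: "'v::euclidean_space \<Rightarrow> 'v list \<Rightarrow> real" where
  "covec v ws = (case ws of [x] \<Rightarrow> inner v x | _ \<Rightarrow> 0)"

primrec flats :: "'v::euclidean_space list \<Rightarrow> 'v list \<Rightarrow> real" where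
  "flats [] = unit_form"
| "flats (v # vs) = wedge (covec v) (flats vs)"

lemma interior_covec: "interior x (covec v) = (\<lambda>ws. inner v x * unit_form ws)"
  by (auto simp: interior_def covec_def unit_form_def fun_eq_iff split: list.splits)

lemma grade_inv_covec: "grade_inv (covec v) = (\<lambda>ws. - covec v ws)"
  by (auto simp: grade_inv_def covec_def fun_eq_iff split: list.splits)

lemma wedge_scale_left: "wedge (\<lambda>vs. c * \<alpha> vs) \<beta> vs = c * wedge \<alpha> \<beta> vs"
  by (simp add: wedge_def sum_distrib_left algebra_simps)

lemma wedge_covec_self: "wedge (covec v) (covec v) vs = 0"
  using wedge_commute_aux[of "covec v" "covec v" vs]
  by (simp add: grade_inv_covec wedge_minus_left)

lemma multilinear_covec: "multilinear (covec v)"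
proof -
  have "linear (\<lambda>x. case us @ x # ws of [x] \<Rightarrow> inner v x | _ \<Rightarrow> 0)" for us ws
    by (cases us; cases ws) (auto simp: linear_iff inner_add_right split: list.splits)
  then show ?thesis by (simp add: multilinear_def covec_def)
qed

lemma multilinear_flats: "multilinear (flats vs)"
proof (induction vs)
  case Nil
  show ?case by (auto simp: multilinear_def unit_form_def linear_iff)
qed (simp add: multilinear_wedge multilinear_covec)

lemma alternating_covec: "alternating (covec v)"
  by (auto simp: alternating_def covec_def split: list.splits)

lemma alternating_flats: "alternating (flats vs)"
proof (induction vs)
  case Nil
  show ?case by (auto simp: alternating_def unit_form_def)
qed (simp add: alternating_wedge multilinear_covec multilinear_flats alternating_covec)

lemma lie_covec:
  assumes "\<And>x y. inner x (A y) = - inner (A x) y"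
  shows "lie A (covec v) = (\<lambda>ws. - covec (A v) ws)"
proof
  show "lie A (covec v) ws = - covec (A v) ws" for ws
  proof (cases ws)
    case (Cons x xs)
    have "lie A unit_form zs = 0" for zs :: "'a list"
      by (cases zs) (simp_all add: lie_zero, simp add: unit_form_def)
    then have "lie A (\<lambda>ws. c * unit_form ws) zs = 0" for c and zs :: "'a list"
      by (simp add: lie_scale)
    then show ?thesis
      using Cons assms by (auto simp: interior_covec covec_def split: list.splits)
  qed (simp add: covec_def)
qed

text \<open>Here \<open>lie\<close> acts on the list that parametrises the form, not on its
  arguments, so the fixed factor \<open>\<gamma>\<close> passes through.\<close>

lemma lie_wedge_param:
  "lie A (\<lambda>vs. wedge \<gamma> (\<Phi> vs) xs) ws = wedge \<gamma> (\<lambda>xs. lie A (\<lambda>vs. \<Phi> vs xs) ws) xs"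
  by (induction ws arbitrary: \<Phi>) (simp_all add: interior_eq wedge_add_right)

text \<open>Metric duality is equivariant for skew \<open>A\<close>: acting on the arguments is
  minus acting on the vectors wedged together.\<close>

lemma lie_flats:
  assumes "\<And>x y. inner x (A y) = - inner (A x) y"
  shows "lie A (flats vs) xs = - lie A (\<lambda>vs. flats vs xs) vs"
proof (induction vs arbitrary: xs)
  case Nil
  show ?case by (cases xs) (simp_all add: lie_zero, simp add: unit_form_def)
next
  case (Cons v vs)
  have IH: "lie A (flats vs) = (\<lambda>xs. - lie A (\<lambda>vs. flats vs xs) vs)" using Cons.IH by blast
  show ?case
    by (simp add: lie_wedge lie_covec[OF assms] wedge_minus_left wedge_minus_right IH
        interior_eq[of v "\<lambda>vs. flats vs xs"] lie_wedge_param[of A "covec v" flats])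
qed

lemma linear_flats: "linear (\<lambda>v. flats (us @ v # ws) xs)"
proof (induction us arbitrary: xs)
  case Nil
  have "linear (\<lambda>v. covec v xs)" for xs :: "'a list"
    by (cases xs rule: remdups_adj.cases) (auto simp: covec_def linear_iff inner_add_left)
  then show ?case by (simp add: linear_wedge_head)
qed (simp add: linear_wedge_head)

lemma flats_adjacent: "flats (us @ v # v # ws) = (\<lambda>xs. 0)"
proof (induction us)
  case Nil
  have cc: "wedge (covec v) (covec v) = (\<lambda>xs. 0)" by (simp add: fun_eq_iff wedge_covec_self)
  show ?case by (simp add: fun_eq_iff cc flip: wedge_assoc)
qed (simp add: fun_eq_iff[where f = "wedge _ _"])

lemma interior_flats_orthogonal:
  "(\<And>v. v \<in> set vs \<Longrightarrow> inner v u = 0) \<Longrightarrow> interior u (flats vs) = (\<lambda>xs. 0)"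
  by (induction vs) (simp_all add: interior_wedge interior_covec)

text \<open>\<open>flats ts\<close> vanishes on arguments orthogonal to \<open>ts\<close>, so these
  all go to \<open>\<alpha>\<close>; standing first, they cost no sign.\<close>

lemma wedge_flats_append:
  assumes "\<And>u t. u \<in> set us \<Longrightarrow> t \<in> set ts \<Longrightarrow> inner t u = 0"
  shows "wedge \<alpha> (flats ts) (us @ xs) = wedge (\<lambda>zs. \<alpha> (us @ zs)) (flats ts) xs"
  using assms
proof (induction us arbitrary: \<alpha>)
  case (Cons u us)
  have "interior u (flats ts) = (\<lambda>xs. 0)"
    using Cons.prems by (intro interior_flats_orthogonal) auto
  then show ?case using Cons by (simp add: wedge_Cons) (simp add: interior_def)
qed simp

lemma flats_self:
  assumes "distinct ts" "set ts \<subseteq> Basis"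
  shows "flats ts ts = 1"
  using assms
proof (induction ts)
  case Nil
  show ?case by (simp add: unit_form_def)
next
  case (Cons t ts)
  have "interior t (flats ts) = (\<lambda>xs. 0)"
    using Cons.prems by (intro interior_flats_orthogonal) (auto simp: inner_Basis)
  then show ?case
    using Cons by (simp add: wedge_Cons interior_covec wedge_scale_left wedge_unit_left)
qed

text \<open>
  The form \<open>w\<close> below is the Hodge dual of \<open>\<alpha>\<close>, up to sign: \<open>w(v\<^sub>1, \<dots>) = (\<alpha> \<and> v\<^sub>1 \<and> \<dots>)(us @ ts)\<close>
  for the basis \<open>us @ ts\<close>.
\<close>

lemma invariant_form_zero_by_duality:
  fixes \<alpha> :: "'v::euclidean_space list \<Rightarrow> real"
  assumes \<alpha>: "multilinear \<alpha>" "alternating \<alpha>" "\<And>vs. length vs \<noteq> n \<Longrightarrow> \<alpha> vs = 0"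
    and inv: "\<And>A vs. A \<in> \<A> \<Longrightarrow> lie A \<alpha> vs = 0"
    and skew: "\<And>A x y. A \<in> \<A> \<Longrightarrow> inner x (A y) = - inner (A x) y"
    and dual: "\<And>w vs. multilinear w \<Longrightarrow> alternating w \<Longrightarrow> (\<And>A vs. A \<in> \<A> \<Longrightarrow> lie A w vs = 0)
      \<Longrightarrow> set vs \<subseteq> Basis \<Longrightarrow> length vs + n = DIM('v) \<Longrightarrow> w vs = 0"
    and us: "set us \<subseteq> Basis"
  shows "\<alpha> us = 0"
proof (cases "distinct us \<and> length us = n")
  case False
  then show ?thesis using \<alpha>(2,3) by (auto simp: alternating_def)
next
  case True
  obtain ts where ts: "set ts = Basis - set us" "distinct ts"
    using finite_distinct_list[of "Basis - set us"] by auto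
  let ?E = "us @ ts"
  have E: "distinct ?E" "set ?E = Basis" using us True ts by auto
  then have len: "length ts + n = DIM('v)"
    using True distinct_card[of ?E] by simp
  define w where "w vs = wedge \<alpha> (flats vs) ?E" for vs
  have ml: "multilinear w"
    unfolding multilinear_def w_def by (intro allI linear_wedge_head linear_flats)
  have alt: "alternating w"
    using alternating_iff_adjacent[OF ml] by (simp add: w_def flats_adjacent)
  have "lie A w vs = 0" if A: "A \<in> \<A>" for A vs
  proof -
    have f: "lie A (flats vs) = (\<lambda>xs. - lie A (\<lambda>vs. flats vs xs) vs)"
      by (rule ext, rule lie_flats[OF skew[OF A]])
    have "inner v (A v) = 0" for v
      using skew[OF A, of v v] by (simp add: inner_commute)
    \<comment> \<open>The action on a full basis vanishes for skew \<open>A\<close>. The Leibniz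
      rule splits this zero into the action on \<open>\<alpha>\<close>, zero by invariance, and
      minus the action on \<open>w\<close>.\<close>
    then have "0 = lie A (\<lambda>ws. wedge \<alpha> (flats vs) ([] @ ws)) ?E"
      using \<alpha> E
      by (intro lie_volume[symmetric] multilinear_wedge alternating_wedge multilinear_flats alternating_flats) auto
    also have "\<dots> = wedge \<alpha> (lie A (flats vs)) ?E"
    proof -
      have "lie A \<alpha> = (\<lambda>vs. 0)" using inv[OF A] by blast
      then show ?thesis by (simp add: lie_wedge)
    qed
    also have "\<dots> = - lie A w vs"
      by (simp add: f wedge_minus_right w_def[abs_def] lie_wedge_param[of A \<alpha> flats])
    finally show ?thesis by simp
  qed
  then have "w ts = 0"
    using dual[OF ml alt] ts len by auto
  \<comment> \<open>Evaluating on the complementary basis vectors recovers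
    \<open>\<alpha> us\<close>: the degree of \<open>\<alpha>\<close> is used up by
    \<open>us\<close>, leaving \<open>flats ts\<close> to act on \<open>ts\<close>.\<close>
  moreover have "w ts = \<alpha> us"
  proof -
    have orth: "inner t u = 0" if "u \<in> set us" "t \<in> set ts" for t u
      using that us ts by (auto simp: inner_Basis)
    have "\<alpha> (us @ zs) = \<alpha> us * unit_form zs" for zs
      using \<alpha>(3)[of "us @ zs"] True by (cases zs) (auto simp: unit_form_def)
    then have "w ts = \<alpha> us * flats ts ts"
      by (simp add: w_def wedge_flats_append[OF orth] wedge_scale_left wedge_unit_left)
    then show ?thesis using flats_self[OF ts(2)] ts(1) by auto
  qed
  ultimately show ?thesis by simp
qed

lemma multilinear_zero_of_Basis:
  assumes "multilinear \<alpha>" "\<And>vs. set vs \<subseteq> Basis \<Longrightarrow> \<alpha> vs = 0"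
  shows "\<alpha> vs = 0"
proof -
  have "\<alpha> (us @ ws) = 0" if "set ws \<subseteq> Basis" for us ws
    using that
  proof (induction us arbitrary: ws rule: rev_induct)
    case Nil
    then show ?case using assms(2) by simp
  next
    case (snoc x us)
    have lin: "linear (\<lambda>x. \<alpha> (us @ x # ws))" using assms(1) by (simp add: multilinear_def)
    have "\<alpha> (us @ x # ws) = \<alpha> (us @ (\<Sum>b\<in>Basis. inner x b *\<^sub>R b) # ws)"
      by (simp add: euclidean_representation)
    also have "\<dots> = (\<Sum>b\<in>Basis. inner x b * \<alpha> (us @ b # ws))"
      by (simp add: linear_sum[OF lin] linear_scale[OF lin])
    also have "\<dots> = 0" using snoc by (intro sum.neutral) auto
    finally show ?case by simp
  qed
  from this[of "[]" vs] show ?thesis by simp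
qed

section \<open>Invariant 4-forms\<close>

unbundle bit_operations_syntax

text \<open>The order is 1, i, j, k, e, f, g, h in the first summand, then in the second: bit 3
  selects the summand, and multiplying units adds bits 0 to 2 modulo 2.\<close>

definition bas_list :: "(octo \<times> octo) list" where
  "bas_list = [
     (((1, 0, 0, 0), (0, 0, 0, 0)), ((0, 0, 0, 0), (0, 0, 0, 0))),
     (((0, 1, 0, 0), (0, 0, 0, 0)), ((0, 0, 0, 0), (0, 0, 0, 0))),
     (((0, 0, 1, 0), (0, 0, 0, 0)), ((0, 0, 0, 0), (0, 0, 0, 0))),
     (((0, 0, 0, 1), (0, 0, 0, 0)), ((0, 0, 0, 0), (0, 0, 0, 0))),
     (((0, 0, 0, 0), (1, 0, 0, 0)), ((0, 0, 0, 0), (0, 0, 0, 0))),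
     (((0, 0, 0, 0), (0, 1, 0, 0)), ((0, 0, 0, 0), (0, 0, 0, 0))),
     (((0, 0, 0, 0), (0, 0, 1, 0)), ((0, 0, 0, 0), (0, 0, 0, 0))),
     (((0, 0, 0, 0), (0, 0, 0, 1)), ((0, 0, 0, 0), (0, 0, 0, 0))),
     (((0, 0, 0, 0), (0, 0, 0, 0)), ((1, 0, 0, 0), (0, 0, 0, 0))),
     (((0, 0, 0, 0), (0, 0, 0, 0)), ((0, 1, 0, 0), (0, 0, 0, 0))),
     (((0, 0, 0, 0), (0, 0, 0, 0)), ((0, 0, 1, 0), (0, 0, 0, 0))),
     (((0, 0, 0, 0), (0, 0, 0, 0)), ((0, 0, 0, 1), (0, 0, 0, 0))),
     (((0, 0, 0, 0), (0, 0, 0, 0)), ((0, 0, 0, 0), (1, 0, 0, 0))),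
     (((0, 0, 0, 0), (0, 0, 0, 0)), ((0, 0, 0, 0), (0, 1, 0, 0))),
     (((0, 0, 0, 0), (0, 0, 0, 0)), ((0, 0, 0, 0), (0, 0, 1, 0))),
     (((0, 0, 0, 0), (0, 0, 0, 0)), ((0, 0, 0, 0), (0, 0, 0, 1)))]"

definition bas :: "nat \<Rightarrow> octo \<times> octo" where
  "bas i = bas_list ! i"

text \<open>Entry \<open>u\<close> of row \<open>i\<close> is the sign in the product of the basis octonions number \<open>i\<close> and \<open>u\<close>.\<close>

definition oct_sign :: "nat \<Rightarrow> nat \<Rightarrow> real" where
  "oct_sign u i = [[1, 1, 1, 1, 1, 1, 1, 1], [1, -1, 1, -1, 1, -1, -1, 1],
     [1, -1, -1, 1, 1, 1, -1, -1], [1, 1, -1, -1, 1, -1, 1, -1], [1, -1, -1, -1, -1, 1, 1, 1],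
     [1, 1, -1, 1, -1, -1, -1, 1], [1, 1, 1, -1, -1, 1, -1, -1], [1, -1, 1, 1, -1, -1, 1, -1]] ! i ! u"

text \<open>For \<open>u = 0\<close> the operator sends (x, y) to (-y, x), whence the extra sign;
  the others multiply both summands on the right by the same unit.\<close>

definition bas_sign :: "nat \<Rightarrow> nat \<Rightarrow> real" where
  "bas_sign u i = (if i < 8 then oct_sign u i else if u = 0 then - 1 else oct_sign u (i - 8))"

lemma ball_8: "(\<forall>i<8. P (i::nat)) \<longleftrightarrow> P 0 \<and> P 1 \<and> P 2 \<and> P 3 \<and> P 4 \<and> P 5 \<and> P 6 \<and> P 7"
  by (simp add: numeral_eq_Suc All_less_Suc conj_ac)

lemma ball_16: "(\<forall>i<16. P (i::nat)) \<longleftrightarrow> (\<forall>i<8. P i) \<and> (\<forall>i<8. P (i + 8))"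
proof (intro iffI conjI allI impI)
  fix i :: nat assume P: "(\<forall>i<8. P i) \<and> (\<forall>i<8. P (i + 8))" and i: "i < 16"
  show "P i"
  proof (cases "i < 8")
    case False
    then have "i - 8 < 8" "i = i - 8 + 8" using i by auto
    then show ?thesis using P by metis
  qed (use P in simp)
qed auto

lemma Basis_bas: "Basis = bas ` {..<16}"
proof -
  have "bas ` {..<16} = set bas_list"
    using nth_image[of 16 bas_list] by (simp add: bas_def[abs_def] bas_list_def atLeast0LessThan)
  also have "\<dots> = Basis"
    by (rule subset_antisym) (simp_all add: bas_list_def Basis_prod_def image_Un zero_prod_def)
  finally show ?thesis ..
qed

text \<open>Numbered so that \<open>u\<close> is also the number of the octonion unit involved.
  Commutators of these eight give all other \<open>J\<close>, up to a factor.\<close>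

definition spin_J :: "nat \<Rightarrow> octo \<times> octo \<Rightarrow> octo \<times> octo" where
  "spin_J u = J (Suc u) 9"

lemma spin_J_simps:
  "spin_J 0 (x, y) = (- y, x)"
  "u \<in> {1..7} \<Longrightarrow> spin_J u (x, y) = (R_mult (imag_unit (Suc u)) y, R_mult (imag_unit (Suc u)) x)"
  by (auto simp: spin_J_def J_def spin9_def)

lemma linear_spin_J: "u < 8 \<Longrightarrow> linear (spin_J u)"
  unfolding spin_J_def J_def by (intro linear_compose linear_spin9) auto

lemma spin_J_square: "u < 8 \<Longrightarrow> spin_J u (spin_J u X) = - X"
  unfolding spin_J_def by (rule J_square) auto

text \<open>With the basis octonions numbered from 0, the index of a product is the bitwise exclusive or.\<close>

lemma spin_J_bas:
  assumes "u < 8" "i < 16"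
  shows "spin_J u (bas i) = bas_sign u i *\<^sub>R bas (i XOR (8 + u))"
proof -
  have "\<forall>u<8. \<forall>i<16. spin_J u (bas i) = bas_sign u i *\<^sub>R bas (i XOR (8 + u))"
    by (simp only: ball_16 ball_8, intro conjI)
      (simp_all add: spin_J_simps bas_def bas_list_def bas_sign_def oct_sign_def R_mult_imag_unit
        flip: numeral_2_eq_2)
  then show ?thesis using assms by blast
qed

definition bit_sign :: "nat \<Rightarrow> nat \<Rightarrow> real" where
  "bit_sign k i = (if bit i k then - 1 else 1)"

lemma bit_sign_xor: "bit_sign k (i XOR j) = bit_sign k i * bit_sign k j"
  by (simp add: bit_sign_def bit_xor_iff)

lemma xor_less_16:
  assumes "a < 16" "b < 16"
  shows "a XOR b < (16 :: nat)"
  using assms take_bit_nat_eq_self_iff[of 4 a] take_bit_nat_eq_self_iff[of 4 b]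
    take_bit_nat_eq_self_iff[of 4 "a XOR b"] take_bit_xor[of 4 a b] by simp

lemma eq_0_of_bit_signs:
  assumes "i < 16" "\<And>k. k < 4 \<Longrightarrow> bit_sign k i = 1"
  shows "i = 0"
proof (rule bit_eqI)
  fix k
  have "take_bit 4 i = i" using assms(1) take_bit_nat_eq_self_iff[of 4 i] by simp
  then have "bit i k \<Longrightarrow> k < 4" by (metis bit_take_bit_iff)
  moreover have "k < 4 \<Longrightarrow> \<not> bit i k" using assms(2)[of k] by (auto simp: bit_sign_def)
  ultimately show "bit i k = bit 0 k" by auto
qed

text \<open>
  Words in the operators \<open>spin_J u\<close> that act diagonally, by the \<open>k\<close>-th bit character. The order of the
  letters 1 and 0 in the last word makes its sign come out right.
\<close>

definition bit_word :: "nat \<Rightarrow> nat list" where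
  "bit_word k = [[1, 3, 5, 7], [2, 3, 6, 7], [4, 5, 6, 7], [1, 0, 2, 3, 4, 5, 6, 7]] ! k"

lemma bit_word_bas:
  assumes "k < 4" "i < 16"
  shows "foldr spin_J (bit_word k) (bas i) = bit_sign k i *\<^sub>R bas i"
proof -
  have k: "k = 0 \<or> k = 1 \<or> k = 2 \<or> k = 3" using assms by auto
  have "\<forall>i<16. foldr spin_J (bit_word k) (bas i) = bit_sign k i *\<^sub>R bas i"
    using k
    by (elim disjE; simp only: ball_16 ball_8; intro conjI)
      (simp_all add: bit_word_def spin_J_bas bit_sign_def bas_sign_def oct_sign_def
        linear_scale[OF linear_spin_J] linear_neg[OF linear_spin_J] bit_Suc_0_iff
        flip: numeral_2_eq_2 numeral_3_eq_3)
  then show ?thesis using assms by blast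
qed

lemma multilinear_scale_4:
  fixes \<alpha> :: "'v::real_vector list \<Rightarrow> real"
  assumes "multilinear \<alpha>"
  shows "\<alpha> [p *\<^sub>R x, q *\<^sub>R y, r *\<^sub>R z, s *\<^sub>R t] = p * q * r * s * \<alpha> [x, y, z, t]"
proof -
  have l: "\<alpha> (us @ (c *\<^sub>R v) # ws) = c * \<alpha> (us @ v # ws)" for us c v ws
    using assms linear_scale unfolding multilinear_def by fastforce
  show ?thesis
    using l[of "[]" p x] l[of "[_]" q y] l[of "[_, _]" r z] l[of "[_, _, _]" s t] by simp
qed

lemma alternating_swap:
  fixes \<alpha> :: "'v::real_vector list \<Rightarrow> real"
  assumes "multilinear \<alpha>" "alternating \<alpha>"
  shows "\<alpha> (us @ v # w # ws) = - \<alpha> (us @ w # v # ws)"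
proof -
  have l1: "linear (\<lambda>x. \<alpha> (us @ x # y # ws))" for y
    using assms by (simp add: multilinear_def)
  have l2: "linear (\<lambda>x. \<alpha> (us @ y # x # ws))" for y
    using assms(1)[unfolded multilinear_def, rule_format, of "us @ [y]" ws] by simp
  have 0: "\<alpha> (us @ x # x # ws) = 0" for x using assms(2) by (simp add: alternating_def)
  have "0 = \<alpha> (us @ (v + w) # (v + w) # ws)" using 0 by simp
  also have "\<dots> = \<alpha> (us @ v # w # ws) + \<alpha> (us @ w # v # ws)"
    unfolding linear_add[OF l1] linear_add[OF l2] using 0 by simp
  finally show ?thesis by linarith
qed

section \<open>The linear system for the components of an invariant 4-form\<close>

context
  fixes \<alpha> :: "(octo \<times> octo) list \<Rightarrow> real" and W :: "nat \<Rightarrow> nat \<Rightarrow> nat \<Rightarrow> nat \<Rightarrow> real"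
  assumes \<alpha>: "multilinear \<alpha>" "alternating \<alpha>"
    and inv: "\<And>u vs. u < 8 \<Longrightarrow> lie (spin_J u) \<alpha> vs = 0"
  defines "W a b c d \<equiv> \<alpha> [bas a, bas b, bas c, bas d]"
begin

lemma W_swap: "W a b c d = - W b a c d" "W a b c d = - W a c b d" "W a b c d = - W a b d c"
  unfolding W_def
  using alternating_swap[OF \<alpha>, of "[]" "bas a" "bas b" "[bas c, bas d]"]
    alternating_swap[OF \<alpha>, of "[bas a]" "bas b" "bas c" "[bas d]"]
    alternating_swap[OF \<alpha>, of "[bas a, bas b]" "bas c" "bas d" "[]"]
  by simp_all

text \<open>The guards make the transpositions terminate as rewrite rules, so each unknown gets a
  normal form with sorted indices.\<close>

lemma W_sort:
  "b < a \<Longrightarrow> W a b c d = - W b a c d" "c < b \<Longrightarrow> W a b c d = - W a c b d"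
  "d < c \<Longrightarrow> W a b c d = - W a b d c"
  by (rule W_swap)+

lemma W_repeat: "W a a c d = 0" "W a b b d = 0" "W a b c c = 0"
  using \<alpha>(2) by (simp_all add: W_def alternating_def)

lemma \<alpha>_spin_J: "u < 8 \<Longrightarrow> \<alpha> (map (spin_J u) vs) = \<alpha> vs"
  by (intro lie_zero_imp_invariant \<alpha> inv linear_spin_J spin_J_square)

lemma \<alpha>_foldr_spin_J: "set us \<subseteq> {..<8} \<Longrightarrow> \<alpha> (map (foldr spin_J us) vs) = \<alpha> vs"
proof (induction us)
  case (Cons u us)
  then show ?case using \<alpha>_spin_J[of u "map (foldr spin_J us) vs"] by (simp add: o_def)
qed (simp add: id_def)

lemma W_spin_J:
  assumes "u < 8" "a < 16" "b < 16" "c < 16" "d < 16"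
  shows "W a b c d = bas_sign u a * bas_sign u b * bas_sign u c * bas_sign u d *
    W (a XOR (8 + u)) (b XOR (8 + u)) (c XOR (8 + u)) (d XOR (8 + u))"
  using \<alpha>_spin_J[OF assms(1), of "[bas a, bas b, bas c, bas d]"] assms
  by (simp add: W_def spin_J_bas multilinear_scale_4[OF \<alpha>(1)])

lemma W_lie:
  assumes "u < 8" "a < 16" "b < 16" "c < 16" "d < 16"
  shows "bas_sign u a * W (a XOR (8 + u)) b c d + bas_sign u b * W a (b XOR (8 + u)) c d +
    bas_sign u c * W a b (c XOR (8 + u)) d + bas_sign u d * W a b c (d XOR (8 + u)) = 0"
proof -
  have "\<alpha> [p *\<^sub>R x, y, z, t] = p * \<alpha> [x, y, z, t]" "\<alpha> [x, p *\<^sub>R y, z, t] = p * \<alpha> [x, y, z, t]"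
    "\<alpha> [x, y, p *\<^sub>R z, t] = p * \<alpha> [x, y, z, t]" "\<alpha> [x, y, z, p *\<^sub>R t] = p * \<alpha> [x, y, z, t]" for p x y z t
    using multilinear_scale_4[OF \<alpha>(1), of _ x _ y _ z _ t] by (metis mult_1 mult.right_neutral
      scaleR_one)+
  then show ?thesis
    using inv[OF assms(1), of "[bas a, bas b, bas c, bas d]"] assms
    by (simp add: W_def interior_def spin_J_bas)
qed

lemma W_zero_of_xor:
  assumes "a < 16" "b < 16" "c < 16" "d < 16" "d \<noteq> a XOR b XOR c"
  shows "W a b c d = 0"
proof (rule ccontr)
  assume nz: "W a b c d \<noteq> 0"
  have "bit_sign k (a XOR b XOR c XOR d) = 1" if k: "k < 4" for k
  proof -
    have "k = 0 \<or> k = 1 \<or> k = 2 \<or> k = 3" using k by auto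
    then have "set (bit_word k) \<subseteq> {..<8}" by (auto simp: bit_word_def)
    \<comment> \<open>The word for bit \<open>k\<close> fixes the form but multiplies this component
      by the \<open>k\<close>-th character of the index sum.\<close>
    from \<alpha>_foldr_spin_J[OF this, of "[bas a, bas b, bas c, bas d]"]
    have "bit_sign k (a XOR b XOR c XOR d) * W a b c d = W a b c d"
      using assms k by (simp add: W_def bit_word_bas multilinear_scale_4[OF \<alpha>(1)] bit_sign_xor
        mult.assoc)
    then show ?thesis using nz by simp
  qed
  then have "a XOR b XOR c XOR d = 0"
    using assms by (intro eq_0_of_bit_signs xor_less_16)
  then have "(a XOR b XOR c) XOR (a XOR b XOR c XOR d) = a XOR b XOR c" by simp
  moreover have "(a XOR b XOR c) XOR (a XOR b XOR c XOR d) = d"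
    by (rule bit_eqI) (auto simp: bit_xor_iff)
  ultimately show False using assms(5) by simp
qed

text \<open>
  For each plane \<open>{0, a, b, c}\<close> in the first factor, the equations \<open>W_lie\<close> with last argument 8
  express all unknowns by \<open>g t = W 0 t 8 (8 + t)\<close>; in particular \<open>W 0 a b c\<close> is \<open>g a + g b + g c\<close> up
  to sign. For the complementary plane they give minus the value that translation invariance
  requires, so \<open>g a + g b + g c = 0\<close> on each of the seven lines of the Fano plane, whence \<open>g = 0\<close>.
\<close>

lemma W_8_zero:
  "\<forall>a<8. \<forall>b<8. W a b 8 (8 + (a XOR b)) = 0" "\<forall>a<8. \<forall>b<8. W 0 a b (a XOR b) = 0"
proof -
  \<comment> \<open>The index 1 is written \<open>Suc 0\<close> below to match the simplified
    equations, while 2 and 3 are restored to numerals.\<close>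
  note [simp] = W_sort W_repeat bas_sign_def oct_sign_def numeral_2_eq_2[symmetric]
    numeral_3_eq_3[symmetric]
  note E = W_lie[where d = 8]
  \<comment> \<open>In each plane \<open>u\<close> runs through the four points and the other three
    are arguments; moving 8 completes the plane. These are four equations in seven unknowns, solved
    in terms of three values of \<open>g\<close>.\<close>
  have p123: "W 2 3 8 9 = W 0 (Suc 0) 8 9"
    "W (Suc 0) 3 8 10 = - W 0 2 8 10"
    "W (Suc 0) 2 8 11 = W 0 3 8 11"
    "W 0 (Suc 0) 2 3 = W 0 (Suc 0) 8 9 + W 0 2 8 10 + W 0 3 8 11"
    using E[of 3 0 "Suc 0" 2, simplified] E[of 2 0 "Suc 0" 3, simplified]
      E[of "Suc 0" 0 2 3, simplified] E[of 0 "Suc 0" 2 3, simplified]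
    by - linarith+
  have p145: "W 4 5 8 9 = W 0 (Suc 0) 8 9"
    "W (Suc 0) 5 8 12 = - W 0 4 8 12"
    "W (Suc 0) 4 8 13 = W 0 5 8 13"
    "W 0 (Suc 0) 4 5 = W 0 (Suc 0) 8 9 + W 0 4 8 12 + W 0 5 8 13"
    using E[of 5 0 "Suc 0" 4, simplified] E[of 4 0 "Suc 0" 5, simplified]
      E[of "Suc 0" 0 4 5, simplified] E[of 0 "Suc 0" 4 5, simplified]
    by - linarith+
  have p167: "W 6 7 8 9 = - W 0 (Suc 0) 8 9"
    "W (Suc 0) 7 8 14 = W 0 6 8 14"
    "W (Suc 0) 6 8 15 = - W 0 7 8 15"
    "W 0 (Suc 0) 6 7 = - W 0 (Suc 0) 8 9 - W 0 6 8 14 - W 0 7 8 15"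
    using E[of 7 0 "Suc 0" 6, simplified] E[of 6 0 "Suc 0" 7, simplified]
      E[of "Suc 0" 0 6 7, simplified] E[of 0 "Suc 0" 6 7, simplified]
    by - linarith+
  have p246: "W 4 6 8 10 = W 0 2 8 10"
    "W 2 6 8 12 = - W 0 4 8 12"
    "W 2 4 8 14 = W 0 6 8 14"
    "W 0 2 4 6 = W 0 2 8 10 + W 0 4 8 12 + W 0 6 8 14"
    using E[of 6 0 2 4, simplified] E[of 4 0 2 6, simplified] E[of 2 0 4 6, simplified]
      E[of 0 2 4 6, simplified]
    by - linarith+
  have p257: "W 5 7 8 10 = W 0 2 8 10"
    "W 2 7 8 13 = - W 0 5 8 13"
    "W 2 5 8 15 = W 0 7 8 15"
    "W 0 2 5 7 = W 0 2 8 10 + W 0 5 8 13 + W 0 7 8 15"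
    using E[of 7 0 2 5, simplified] E[of 5 0 2 7, simplified] E[of 2 0 5 7, simplified]
      E[of 0 2 5 7, simplified]
    by - linarith+
  have p347: "W 4 7 8 11 = W 0 3 8 11"
    "W 3 7 8 12 = - W 0 4 8 12"
    "W 3 4 8 15 = W 0 7 8 15"
    "W 0 3 4 7 = W 0 3 8 11 + W 0 4 8 12 + W 0 7 8 15"
    using E[of 7 0 3 4, simplified] E[of 4 0 3 7, simplified] E[of 3 0 4 7, simplified]
      E[of 0 3 4 7, simplified]
    by - linarith+
  have p356: "W 5 6 8 11 = - W 0 3 8 11"
    "W 3 6 8 13 = W 0 5 8 13"
    "W 3 5 8 14 = - W 0 6 8 14"
    "W 0 3 5 6 = - W 0 3 8 11 - W 0 5 8 13 - W 0 6 8 14"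
    using E[of 6 0 3 5, simplified] E[of 5 0 3 6, simplified] E[of 3 0 5 6, simplified]
      E[of 0 3 5 6, simplified]
    by - linarith+
  \<comment> \<open>Translations by 8 and by 8 + 4 carry the plane to its complement 4, 5, 6, 7. The
    pairs in the equation there are known from \<open>p145\<close>, \<open>p246\<close> and
    \<open>p356\<close>.\<close>
  have z123: "W 0 (Suc 0) 2 3 = 0"
    using W_spin_J[of 0 0 "Suc 0" 2 3, simplified] W_spin_J[of 4 8 9 10 11, simplified]
      E[of 7 4 5 6, simplified] p123 p145 p246 p356
    by linarith
  have z145: "W 0 (Suc 0) 4 5 = 0"
    using W_spin_J[of 0 0 "Suc 0" 4 5, simplified] W_spin_J[of 2 8 9 12 13, simplified]
      E[of 7 2 3 6, simplified] p123 p145 p246 p356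
    by linarith
  have z167: "W 0 (Suc 0) 6 7 = 0"
    using W_spin_J[of 0 0 "Suc 0" 6 7, simplified] W_spin_J[of 2 8 9 14 15, simplified]
      E[of 5 2 3 4, simplified] p123 p167 p246 p347
    by linarith
  have z246: "W 0 2 4 6 = 0"
    using W_spin_J[of 0 0 2 4 6, simplified] W_spin_J[of "Suc 0" 8 10 12 14, simplified]
      E[of 7 "Suc 0" 3 5, simplified] p123 p145 p246 p356
    by linarith
  have z257: "W 0 2 5 7 = 0"
    using W_spin_J[of 0 0 2 5 7, simplified] W_spin_J[of "Suc 0" 8 10 13 15, simplified]
      E[of 6 "Suc 0" 3 4, simplified] p123 p145 p257 p347
    by linarith
  have z347: "W 0 3 4 7 = 0"
    using W_spin_J[of 0 0 3 4 7, simplified] W_spin_J[of "Suc 0" 8 11 12 15, simplified]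
      E[of 6 "Suc 0" 2 5, simplified] p123 p145 p257 p347
    by linarith
  have z356: "W 0 3 5 6 = 0"
    using W_spin_J[of 0 0 3 5 6, simplified] W_spin_J[of "Suc 0" 8 11 13 14, simplified]
      E[of 7 "Suc 0" 2 4, simplified] p123 p145 p246 p356
    by linarith
  \<comment> \<open>Adding all seven line equations shows that the total of \<open>g\<close> is 0;
    the three lines through a point add up to this total plus twice \<open>g\<close> there.\<close>
  have g: "W 0 (Suc 0) 8 9 = 0" "W 0 2 8 10 = 0" "W 0 3 8 11 = 0" "W 0 4 8 12 = 0"
    "W 0 5 8 13 = 0" "W 0 6 8 14 = 0" "W 0 7 8 15 = 0"
    using p123(4)[unfolded z123] p145(4)[unfolded z145] p167(4)[unfolded z167]
      p246(4)[unfolded z246] p257(4)[unfolded z257] p347(4)[unfolded z347] p356(4)[unfolded z356]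
      by - linarith+
  show "\<forall>a<8. \<forall>b<8. W a b 8 (8 + (a XOR b)) = 0" "\<forall>a<8. \<forall>b<8. W 0 a b (a XOR b) = 0"
    by (simp_all add: ball_8 g z123 z145 z167 z246 z257 z347 z356 p123 p145 p167 p246 p257 p347 p356 xor_numerals)
qed

text \<open>Bit 3 of \<open>b\<close>, \<open>c\<close>, \<open>d\<close> sums to 1 modulo 2. Either
  one of them lies in the second summand, and permuting puts 8 in third place, or all three do, and
  translation by 8 moves the plane into the first summand.\<close>

lemma W_8:
  assumes "b < 16" "c < 16" "d = 8 XOR b XOR c"
  shows "W 8 b c d = 0"
proof -
  have lt: "i XOR j < 8" if "i < 8" "j < 8" for i j :: nat
    using that take_bit_nat_eq_self_iff[of 3 i] take_bit_nat_eq_self_iff[of 3 j]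
      take_bit_nat_eq_self_iff[of 3 "i XOR j"] take_bit_xor[of 3 i j] by simp
  have "\<forall>i<8. (8 :: nat) + i = 8 XOR i" by (simp add: ball_8)
  then have x8: "8 + i = 8 XOR i" if "i < 8" for i :: nat using that by blast
  have cancel: "i XOR (i XOR j) = j" for i j :: nat by (simp flip: xor.assoc)
  note ac = xor.assoc xor.commute xor.left_commute cancel
  have pair: "W a b 8 c = 0" if "a < 8" "b < 8" "c = 8 XOR a XOR b" for a b c
  proof -
    have "c = 8 + (a XOR b)" using that x8[OF lt[OF that(1,2)]] by simp
    then show ?thesis using W_8_zero(1) that by simp
  qed
  have split: "i < 8 \<or> (\<exists>j<8. i = 8 XOR j)" if "i < 16" for i :: nat
  proof (cases "i < 8")
    case False
    then have "i - 8 < 8" "i = 8 + (i - 8)" using that by auto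
    then show ?thesis using x8 by metis
  qed simp
  consider "b < 8" "c < 8" | j where "b < 8" "j < 8" "c = 8 XOR j"
    | j where "c < 8" "j < 8" "b = 8 XOR j" | j k where "j < 8" "k < 8" "b = 8 XOR j" "c = 8 XOR k"
    using split[OF assms(1)] split[OF assms(2)] by blast
  then show ?thesis
  proof cases
    case 1
    then show ?thesis
      using pair[of b c d] W_swap(1)[of 8 b c d] W_swap(2)[of b 8 c d] assms(3) by simp
  next
    case 2
    then have "d = b XOR j" using assms(3) by (simp add: ac)
    then have "d < 8" "c = 8 XOR b XOR d" using 2 lt by (auto simp: ac)
    then show ?thesis
      using 2 pair[of b d c] W_swap(1)[of 8 b c d] W_swap(3)[of b 8 c d] W_swap(2)[of b 8 d c] by
        simp
  next
    case 3
    then have "d = c XOR j" using assms(3) by (simp add: ac)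
    then have "d < 8" "b = 8 XOR c XOR d" using 3 lt by (auto simp: ac)
    then show ?thesis
      using 3 pair[of c d b] W_swap(2)[of 8 b c d] W_swap(1)[of 8 c b d] W_swap(3)[of c 8 b d]
        W_swap(2)[of c 8 d b] by simp
  next
    case 4
    then have d: "d = 8 XOR (j XOR k)" using assms(3) by (simp add: ac)
    have "b < 16" "c < 16" "d < 16" using assms d by (auto intro!: xor_less_16)
    moreover have "b XOR 8 = j" "c XOR 8 = k" "d XOR 8 = j XOR k" using 4 d by (simp_all add: ac)
    ultimately show ?thesis
      using W_spin_J[of 0 8 b c d] W_8_zero(2) 4 by simp
  qed
qed

text \<open>Translation by \<open>8 + a\<close> takes a first index \<open>a < 8\<close> to 8;
  translation by \<open>a\<close> takes a first index \<open>a\<close> of at least 8 to 0.\<close>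

lemma W_zero:
  assumes "a < 16" "b < 16" "c < 16" "d < 16"
  shows "W a b c d = 0"
proof -
  have low: "W a b c d = 0" if "a < 8" "b < 16" "c < 16" "d < 16" for a b c d
  proof (cases "d = a XOR b XOR c")
    case True
    let ?s = "8 + a"
    have "?s < 16" using that by simp
    then have lt: "b XOR ?s < 16" "c XOR ?s < 16" using that by (auto intro!: xor_less_16)
    have s: "a XOR ?s = 8"
    proof -
      have "\<forall>a<8. a XOR (8 + a) = (8 :: nat)" by (simp add: ball_8)
      then show ?thesis using that by blast
    qed
    have "d XOR ?s = (a XOR ?s) XOR (b XOR ?s) XOR (c XOR ?s)"
      unfolding True by (rule bit_eqI) (auto simp: bit_xor_iff)
    then show ?thesis
      using W_spin_J[of a a b c d] W_8[OF lt, of "d XOR ?s"] s that by simp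
  qed (use that W_zero_of_xor in auto)
  show ?thesis
  proof (cases "a < 8")
    case False
    then have u: "a - 8 < 8" "a = 8 + (a - 8)" using assms by auto
    then have "W (a XOR a) (b XOR a) (c XOR a) (d XOR a) = 0"
      using assms by (intro low xor_less_16) auto
    then show ?thesis using W_spin_J[of "a - 8" a b c d] u assms by simp
  qed (use assms low in simp)
qed

end

lemma invariant_4_form_zero:
  assumes "multilinear \<alpha>" "alternating \<alpha>" "\<And>u vs. u < 8 \<Longrightarrow> lie (spin_J u) \<alpha> vs = 0"
    and vs: "set vs \<subseteq> Basis" "length vs = 4"
  shows "\<alpha> vs = 0"
proof -
  obtain x y z t where v: "vs = [x, y, z, t]"
    using vs(2) by (auto simp: numeral_eq_Suc length_Suc_conv)
  then obtain a b c d where "x = bas a" "y = bas b" "z = bas c" "t = bas d"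
      "a < 16" "b < 16" "c < 16" "d < 16"
    using vs(1) unfolding Basis_bas by auto
  then show ?thesis using W_zero[OF assms(1-3)] v by simp
qed

section \<open>The coefficients of the characteristic polynomial\<close>

text \<open>With I_9 squaring to 1, cos \<theta> + sin \<theta> I_(u+1) I_9 equals (cos \<theta> I_9
  + sin \<theta> I_(u+1)) I_9. So each rotation is a product of two unit Clifford vectors, whose
  pullbacks fix the coefficient.\<close>

lemma lie_tau:
  assumes "u < 8"
  shows "lie (spin_J u) (eval_form (tau k kaehler_mat)) vs = 0"
proof -
  let ?t = "tau k kaehler_mat"
  define e v :: "real \<Rightarrow> nat \<Rightarrow> real"
    where "e \<theta> a = (if a = 8 then 1 else 0)"
      and "v \<theta> a = (if a = 8 then cos \<theta> else 0) + (if a = u then sin \<theta> else 0)" for \<theta> a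
  have e: "(\<Sum>a<9. (e \<theta> a)\<^sup>2) = 1" for \<theta>
    by (simp add: e_def if_distrib[of "\<lambda>x. x\<^sup>2"] cong: if_cong)
  have "(v \<theta> a)\<^sup>2 = (if a = 8 then (cos \<theta>)\<^sup>2 else 0) + (if a = u then (sin \<theta>)\<^sup>2 else 0)" for \<theta> a
    using assms by (simp add: v_def)
  then have v: "(\<Sum>a<9. (v \<theta> a)\<^sup>2) = 1" for \<theta>
    using assms by (simp add: sum.distrib)
  have "rot (spin_J u) \<theta> X = clifford (v \<theta>) (clifford (e \<theta>) X)" for \<theta> X
  proof -
    have "clifford (e \<theta>) X = spin9 9 X"
    proof -
      have "e \<theta> a *\<^sub>R spin9 (Suc a) X = (if a = 8 then spin9 9 X else 0)" for a
        by (simp add: e_def)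
      then show ?thesis by (simp add: clifford_def)
    qed
    moreover have "clifford (v \<theta>) Y = cos \<theta> *\<^sub>R spin9 9 Y + sin \<theta> *\<^sub>R spin9 (Suc u) Y" for Y
    proof -
      have "v \<theta> a *\<^sub>R spin9 (Suc a) Y =
          (if a = 8 then cos \<theta> *\<^sub>R spin9 9 Y else 0) + (if a = u then sin \<theta> *\<^sub>R spin9 (Suc u) Y else 0)" for a
        by (simp add: v_def scaleR_left_distrib)
      then show ?thesis using assms by (simp add: clifford_def sum.distrib)
    qed
    ultimately show ?thesis by (simp add: rot_def spin_J_def J_def spin9_involution)
  qed
  then have rot: "rot (spin_J u) \<theta> = clifford (v \<theta>) \<circ> clifford (e \<theta>)" for \<theta>
    by (simp add: fun_eq_iff)
  have "eval_form ?t (map (rot (spin_J u) \<theta>) ws) = eval_form ?t ws" for \<theta> ws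
  proof -
    have "eval_form ?t (map (rot (spin_J u) \<theta>) ws)
        = eval_form (pullback (clifford (e \<theta>)) (pullback (clifford (v \<theta>)) ?t)) ws"
      by (simp add: rot eval_pullback[OF linear_clifford])
    then show ?thesis by (simp add: pullback_clifford_tau e v)
  qed
  then show ?thesis
    using lie_zero_iff_rot_invariant[OF multilinear_eval_form linear_spin_J[OF assms]
      spin_J_square[OF assms] ]
    by blast
qed

lemma tau_zero_of_Basis:
  assumes "\<And>vs. set vs \<subseteq> Basis \<Longrightarrow> eval_form (tau k kaehler_mat) vs = 0"
  shows "tau k kaehler_mat = 0"
  by (rule even_form_eqI)
    (simp add: eval_zero_form multilinear_zero_of_Basis[OF multilinear_eval_form assms])

lemma tau_2: "tau 2 kaehler_mat = 0"
proof (rule tau_zero_of_Basis)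
  fix vs :: "(octo \<times> octo) list" assume "set vs \<subseteq> Basis"
  then show "eval_form (tau 2 kaehler_mat) vs = 0"
    using invariant_4_form_zero[OF multilinear_eval_form alternating_eval_form lie_tau, of vs]
      tau_in_Lambda[of 2]
    by (cases "length vs = 4") (simp_all add: Lambda_def)
qed

lemma tau_6: "tau 6 kaehler_mat = 0"
proof (rule tau_zero_of_Basis)
  fix vs :: "(octo \<times> octo) list" assume vs: "set vs \<subseteq> Basis"
  show "eval_form (tau 6 kaehler_mat) vs = 0"
  proof (rule invariant_form_zero_by_duality[where n = 12 and \<A> = "spin_J ` {..<8}"])
    show "inner x (A y) = - inner (A x) y" if "A \<in> spin_J ` {..<8}" for A x y
      using that by (auto simp: spin_J_def intro!: J_skew)
    fix w and ws :: "(octo \<times> octo) list"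
    assume w: "multilinear w" "alternating w" "\<And>A vs. A \<in> spin_J ` {..<8} \<Longrightarrow> lie A w vs = 0"
      and ws: "set ws \<subseteq> Basis" "length ws + 12 = DIM(octo \<times> octo)"
    have "length ws = 4" using ws(2) by simp
    then show "w ws = 0"
      using ws(1) invariant_4_form_zero[OF w(1,2), of ws] w(3) by blast
  next
    show "eval_form (tau 6 kaehler_mat) ws = 0" if "length ws \<noteq> 12" for ws
      using tau_in_Lambda[of 6] that by (simp add: Lambda_def)
    show "lie A (eval_form (tau 6 kaehler_mat)) ws = 0" if "A \<in> spin_J ` {..<8}" for A ws
      using that by (elim imageE) (simp add: lie_tau)
  qed (rule multilinear_eval_form alternating_eval_form vs)+
qed

section \<open>Parity of the characteristic polynomial and the final assembly\<close>

lemma even_form_eq_minus_iff: "\<alpha> = - \<alpha> \<longleftrightarrow> \<alpha> = (0 :: 'a::euclidean_space even_form)"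
proof
  assume "\<alpha> = - \<alpha>"
  then have "eval_form \<alpha> vs = eval_form (- \<alpha>) vs" for vs by (rule arg_cong)
  then show "\<alpha> = 0" by (intro even_form_eqI) (simp add: uminus_even_form.rep_eq eval_zero_form)
qed simp

text \<open>Putting -t for t in tI - A gives -(tI + A), and the determinant pulls out the sign
  \<open>n\<close> times.\<close>

lemma char_poly_uminus:
  fixes A :: "'a::comm_ring_1 mat"
  assumes A: "A \<in> carrier_mat n n"
  shows "char_poly (- A) = (-1) ^ n * pcompose (char_poly A) [:0, -1:]"
proof -
  have "map_mat (\<lambda>p. pcompose p [:0, -1:]) (char_poly_matrix A) = (- 1) \<cdot>\<^sub>m char_poly_matrix (- A)"
    using A by (intro eq_matI) (auto simp: char_poly_matrix_def pcompose_pCons)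
  then have "pcompose (char_poly A) [:0, -1:] = det ((- 1) \<cdot>\<^sub>m char_poly_matrix (- A))"
    unfolding char_poly_def by (simp flip: comm_ring_hom.hom_det[OF pcompose_hom.comm_ring_hom_axioms])
  also have "\<dots> = (- 1) ^ n * char_poly (- A)"
    using carrier_matD(2)[OF char_poly_matrix_closed[of "- A" n]] A
    by (simp add: char_poly_def det_smult)
  finally show ?thesis by (simp flip: power_mult_distrib mult.assoc)
qed

lemma kaehler_form_skew:
  assumes "a < 9" "b < 9"
  shows "kaehler_form (Suc a) (Suc b) = - kaehler_form (Suc b) (Suc a)"
proof (rule even_form_eqI)
  fix vs :: "(octo \<times> octo) list"
  have "eval_form (kaehler_form (Suc a) (Suc b)) [X, Y] = - eval_form (kaehler_form (Suc b) (Suc a)) [X, Y]" for X Y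
    unfolding eval_kaehler_form_pair[OF assms] eval_kaehler_form_pair[OF assms(2,1)]
      spin9_clifford_relation[OF assms]
    by (simp add: inner_diff_right)
  then show "eval_form (kaehler_form (Suc a) (Suc b)) vs = eval_form (- kaehler_form (Suc b) (Suc a)) vs"
    using assms
    by (cases "length vs = 2")
      (auto simp: numeral_2_eq_2 length_Suc_conv uminus_even_form.rep_eq eval_kaehler_form_degree)
qed

text \<open>Transposition and skewness identify the polynomials of the matrix and its negative. For
  odd \<open>k\<close> the exponent 9 - k is even, so t to -t keeps the coefficient, while the odd
  size 9 negates it.\<close>

lemma tau_odd:
  assumes "odd k" "k \<le> 9"
  shows "tau k kaehler_mat = 0"
proof -
  have K: "kaehler_mat \<in> carrier_mat 9 9" by (simp add: kaehler_mat_def)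
  have "transpose_mat kaehler_mat = - kaehler_mat"
    by (rule eq_matI) (auto simp: kaehler_mat_def intro: kaehler_form_skew)
  then have "char_poly kaehler_mat = - pcompose (char_poly kaehler_mat) [:0, -1:]"
    using char_poly_transpose_mat[OF K] char_poly_uminus[OF K] by simp
  from arg_cong[OF this, of "\<lambda>p. coeff p (9 - k)"]
  have "coeff (char_poly kaehler_mat) (9 - k) = - coeff (pcompose (char_poly kaehler_mat) [:0, -1:]) (9 - k)"
    by (simp only: coeff_minus)
  also have "\<dots> = - coeff (char_poly kaehler_mat) (9 - k)"
    using assms by (simp add: coeff_pcompose_linear)
  finally show ?thesis
    by (simp only: even_form_eq_minus_iff) (simp add: tau_def kaehler_mat_def)
qed

theorem proposition5p1:
  shows "char_poly kaehler_mat =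
           monom 1 9 + monom (tau 4 kaehler_mat) 5 + monom (tau 8 kaehler_mat) 1 \<and>
         (\<forall>k\<in>{1..9}. k \<noteq> 4 \<and> k \<noteq> 8 \<longrightarrow> tau k kaehler_mat = 0)"
proof
  show tau: "\<forall>k\<in>{1..9}. k \<noteq> 4 \<and> k \<noteq> 8 \<longrightarrow> tau k kaehler_mat = 0"
  proof (intro ballI impI)
    fix k :: nat assume k: "k \<in> {1..9}" "k \<noteq> 4 \<and> k \<noteq> 8"
    show "tau k kaehler_mat = 0"
    proof (cases "odd k")
      case False
      then have "k = 2 \<or> k = 6" using k by (auto elim!: evenE)
      then show ?thesis using tau_2 tau_6 by auto
    qed (use k tau_odd in auto)
  qed
  have K: "kaehler_mat \<in> carrier_mat 9 9" by (simp add: kaehler_mat_def)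
  show "char_poly kaehler_mat =
      monom 1 9 + monom (tau 4 kaehler_mat) 5 + monom (tau 8 kaehler_mat) 1" (is "_ = ?R")
  proof (rule poly_eqI)
    fix m :: nat
    have monic: "degree (char_poly kaehler_mat) = 9" "coeff (char_poly kaehler_mat) 9 = 1"
      using degree_monic_char_poly[OF K] by auto
    consider "m > 9" | "m = 9" | "m < 9" by linarith
    then show "coeff (char_poly kaehler_mat) m = coeff ?R m"
    proof cases
      case 3
      then have "9 - (9 - m) = m" by simp
      then have "coeff (char_poly kaehler_mat) m = tau (9 - m) kaehler_mat"
        using K by (simp add: tau_def)
      \<comment> \<open>The exceptional exponents 5 and 1 correspond to \<open>k\<close> equal to 4
        and 8; exponent 0 is \<open>k\<close> equal to 9.\<close>
      moreover have "tau (9 - m) kaehler_mat = 0" if "m \<noteq> 5" "m \<noteq> 1"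
        using bspec[OF tau, of "9 - m"] 3 that by fastforce
      ultimately show ?thesis using 3 by auto
    qed (use monic in \<open>auto simp: coeff_eq_0\<close>)
  qed
qed

end
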